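(* Let $X\in\Phi_{\mathbb{K}}$. Then there is no bounded $\mathfrak{u}$-frequently hypercyclic linear operator on $X$. In particular, there is no frequently hypercyclic bounded linear operator on $X$.
   Context: $\mathbb{K}$ denotes either $\mathbb{R}$ or $\mathbb{C}$. For a Banach space $X$ over $\mathbb{K}$, $L(X)$ is the algebra of bounded linear operators on $X$. An operator $T\in L(X)$ is strictly singular if the restriction of $T$ to any closed infinite dimensional subspace of $X$ is not an isomorphism onto its image; $\mathcal{S}(X)$ denotes the set (an ideal of $L(X)$) of strictly singular operators. $\Phi_{\mathbb{K}}$ is the class of infinite dimensional Banach spaces $X$ over $\mathbb{K}$ for which $L(X)/\mathcal{S}(X)$ is isomorphic to $\mathbb{K}$; equivalently, every $T\in L(X)$ has the form $T=zI+S$ with $z\in\mathbb{K}$ and $S\in\mathcal{S}(X)$. For $A\subseteq\mathbb{Z}_+$ (non-negative integers), $\underline{d}(A)=\liminf_{n\to\infty}\frac{|\{m\in A:m\leq n\}|}{n}$ is the lower density and $\overline{d}(A)=\limsup_{n\to\infty}\frac{|\{m\in A:m\leq n\}|}{n}$ is the upper density. A continuous linear operator $T$ on a topological vector space $X$ is frequently hypercyclic (respectively $\mathfrak{u}$-frequently hypercyclic) if there is $x\in X$ such that for every non-empty open $U\subseteq X$ the set $\{n\in\mathbb{N}:T^nx\in U\}$ has positive lower (respectively positive upper) density ($\mathbb{N}$ is the set of positive integers). *)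

theory Defs
  imports "HOL-Analysis.Analysis" "HOL-Algebra.QuotRing"
begin

text \<open>
  A Banach space over \<open>'k\<close>, where \<open>'k\<close> is \<^typ>\<open>real\<close> or \<^typ>\<open>complex\<close>. The norm and
  the underlying real Banach space come from the type class; \<open>sc\<close> is the multiplication
  by scalars in \<open>'k\<close>. For \<open>'k = real\<close> the second axiom forces \<open>sc\<close> to be \<^const>\<open>scaleR\<close>.
\<close>

locale banach_space_over = vector_space sc
  for sc :: "'k::real_normed_field \<Rightarrow> 'a::banach \<Rightarrow> 'a" +
  assumes norm_scale: "norm (sc c x) = norm c * norm x"
    and scale_of_real: "sc (of_real r) x = r *\<^sub>R x"

lemma banach_space_over_real:
  "banach_space_over (scaleR :: real \<Rightarrow> 'a::banach \<Rightarrow> 'a)"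
  by unfold_locales (auto simp: algebra_simps)

lemma banach_space_over_complex:
  "banach_space_over ((*) :: complex \<Rightarrow> complex \<Rightarrow> complex)"
  by unfold_locales (auto simp: algebra_simps norm_mult scaleR_conv_of_real)

definition bounded_ops :: "('k::real_normed_field \<Rightarrow> 'a::banach \<Rightarrow> 'a) \<Rightarrow> ('a \<Rightarrow> 'a) set" where
  "bounded_ops sc = {T. Vector_Spaces.linear sc sc T \<and> bounded_linear T}"

definition infinite_dim ::
    "('k::real_normed_field \<Rightarrow> 'a::banach \<Rightarrow> 'a) \<Rightarrow> 'a set \<Rightarrow> bool" where
  "infinite_dim sc M \<longleftrightarrow> \<not> (\<exists>B. finite B \<and> B \<subseteq> M \<and> M \<subseteq> Modules.module.span sc B)"

text \<open>
  The restriction of \<open>T\<close> to \<open>M\<close> is an isomorphism onto its image iff it is a homeomorphism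
  from \<open>M\<close> onto \<open>T ` M\<close>, as \<open>T\<close> is linear and hence so is its inverse.
\<close>

definition strictly_singular_ops ::
    "('k::real_normed_field \<Rightarrow> 'a::banach \<Rightarrow> 'a) \<Rightarrow> ('a \<Rightarrow> 'a) set" where
  "strictly_singular_ops sc =
    {T \<in> bounded_ops sc.
      \<forall>M. Modules.module.subspace sc M \<and> closed M \<and> infinite_dim sc M \<longrightarrow>
        \<not> (\<exists>g. homeomorphism M (T ` M) T g)}"

definition op_ring ::
    "('k::real_normed_field \<Rightarrow> 'a::banach \<Rightarrow> 'a) \<Rightarrow> ('a \<Rightarrow> 'a) ring" where
  "op_ring sc =
    \<lparr>carrier = bounded_ops sc, monoid.mult = (\<lambda>S T. S \<circ> T), one = id,
     ring.zero = (\<lambda>x. 0), add = (\<lambda>S T x. S x + T x)\<rparr>"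

definition scalar_ring :: "'k::real_normed_field ring" where
  "scalar_ring = \<lparr>carrier = UNIV, monoid.mult = (*), one = 1, ring.zero = 0, add = (+)\<rparr>"

text \<open>
  The class \<open>\<Phi>\<close> over \<open>'k\<close>: infinite dimensional Banach spaces for which the quotient of the
  bounded operators by the strictly singular ones is isomorphic to \<open>'k\<close> as a \<open>'k\<close>-algebra.
  Since \<^const>\<open>FactRing\<close> yields only a ring, \<open>'k\<close>-linearity of the isomorphism is stated
  separately, on cosets.
\<close>

definition class_Phi :: "('k::real_normed_field \<Rightarrow> 'a::banach \<Rightarrow> 'a) \<Rightarrow> bool" where
  "class_Phi sc \<longleftrightarrow>
    banach_space_over sc \<and> infinite_dim sc UNIV \<and>
    (\<exists>\<phi> \<in> ring_iso (op_ring sc Quot strictly_singular_ops sc) scalar_ring.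
      \<forall>z. \<forall>T \<in> bounded_ops sc.
        \<phi> (strictly_singular_ops sc +>\<^bsub>op_ring sc\<^esub> (\<lambda>x. sc z (T x))) =
        z * \<phi> (strictly_singular_ops sc +>\<^bsub>op_ring sc\<^esub> T))"

text \<open>
  At \<open>n = 0\<close> the quotient below is \<open>0\<close> by the convention for division by zero; this does not
  affect the limits.
\<close>

definition lower_density :: "nat set \<Rightarrow> ereal" where
  "lower_density A = liminf (\<lambda>n. ereal (real (card {m \<in> A. m \<le> n}) / real n))"

definition upper_density :: "nat set \<Rightarrow> ereal" where
  "upper_density A = limsup (\<lambda>n. ereal (real (card {m \<in> A. m \<le> n}) / real n))"

definition frequently_hypercyclic :: "('a::topological_space \<Rightarrow> 'a) \<Rightarrow> bool" where
  "frequently_hypercyclic T \<longleftrightarrow>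
    (\<exists>x. \<forall>U. open U \<and> U \<noteq> {} \<longrightarrow> lower_density {n. 0 < n \<and> (T ^^ n) x \<in> U} > 0)"

definition u_frequently_hypercyclic :: "('a::topological_space \<Rightarrow> 'a) \<Rightarrow> bool" where
  "u_frequently_hypercyclic T \<longleftrightarrow>
    (\<exists>x. \<forall>U. open U \<and> U \<noteq> {} \<longrightarrow> upper_density {n. 0 < n \<and> (T ^^ n) x \<in> U} > 0)"

text \<open>Every operator on a space in \<open>\<Phi>\<close> is a scalar plus a strictly singular operator.\<close>

lemma class_Phi_decomp:
  fixes sc :: "'k::real_normed_field \<Rightarrow> 'a::banach \<Rightarrow> 'a"
  assumes Phi: "class_Phi sc" and T: "T \<in> bounded_ops sc"
  obtains z S where "S \<in> strictly_singular_ops sc" "T = (\<lambda>x. sc z x + S x)"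
proof -
  let ?L = "op_ring sc" and ?S = "strictly_singular_ops sc"
  interpret banach_space_over sc using Phi by (simp add: class_Phi_def)
  obtain \<phi> where iso: "\<phi> \<in> ring_iso (?L Quot ?S) scalar_ring"
    and lin: "\<And>z T. T \<in> bounded_ops sc \<Longrightarrow>
      \<phi> (?S +>\<^bsub>?L\<^esub> (\<lambda>x. sc z (T x))) = z * \<phi> (?S +>\<^bsub>?L\<^esub> T)"
    using Phi unfolding class_Phi_def by blast
  have id: "id \<in> bounded_ops sc"
    by (simp add: bounded_ops_def id_def linear_ident)
  have one: "\<phi> (?S +>\<^bsub>?L\<^esub> id) = 1"
    using iso by (simp add: ring_iso_def ring_hom_def FactRing_def op_ring_def scalar_ring_def)
  have scaled: "(\<lambda>x. sc z x) \<in> bounded_ops sc" for z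
  proof -
    have "bounded_linear (\<lambda>x. sc z x)"
    proof (rule bounded_linear_intro[where K = "norm z"])
      show "sc z (r *\<^sub>R x) = r *\<^sub>R sc z x" for r x
        by (metis scale_of_real scale_left_commute)
    qed (auto simp: scale_right_distrib norm_scale)
    then show ?thesis by (simp add: bounded_ops_def linear_scale_self)
  qed
  define z where "z = \<phi> (?S +>\<^bsub>?L\<^esub> T)"
  have "\<phi> (?S +>\<^bsub>?L\<^esub> (\<lambda>x. sc z x)) = \<phi> (?S +>\<^bsub>?L\<^esub> T)"
    using lin[OF id, of z] one by (simp add: z_def)
  moreover have "inj_on \<phi> (carrier (?L Quot ?S))"
    using iso by (auto simp: ring_iso_def bij_betw_def)
  moreover have "?S +>\<^bsub>?L\<^esub> A \<in> carrier (?L Quot ?S)" if "A \<in> bounded_ops sc" for A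
    using that by (auto simp: FactRing_def A_RCOSETS_def' op_ring_def a_r_coset_def')
  ultimately have eq: "?S +>\<^bsub>?L\<^esub> (\<lambda>x. sc z x) = ?S +>\<^bsub>?L\<^esub> T"
    using T scaled by (meson inj_onD)
  have zero: "(\<lambda>x. 0) \<in> ?S"
  proof -
    have "\<not> (\<exists>g. homeomorphism M ((\<lambda>x. 0) ` M) (\<lambda>x. 0::'a) g)"
      if "Modules.module.subspace sc M" "infinite_dim sc M" for M
    proof
      assume "\<exists>g. homeomorphism M ((\<lambda>x. 0) ` M) (\<lambda>x. 0::'a) g"
      then have "inj_on (\<lambda>x. 0::'a) M"
        by (metis homeomorphism_def inj_onI)
      then have "M \<subseteq> {0}" using subspace_0[OF that(1)] by (auto simp: inj_on_def)
      then show False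
        using that(2) by (auto simp: infinite_dim_def intro: span_zero dest!: spec[of _ "{}"])
    qed
    moreover have "Vector_Spaces.linear sc sc (\<lambda>x. 0)"
      using linear_scale_self[of 0] by simp
    ultimately show ?thesis
      by (auto simp: strictly_singular_ops_def bounded_ops_def)
  qed
  have "T \<in> ?S +>\<^bsub>?L\<^esub> T"
    using zero by (force simp: a_r_coset_def' op_ring_def)
  then obtain S where "S \<in> ?S" "T = (\<lambda>x. S x + sc z x)"
    unfolding eq[symmetric] by (auto simp: a_r_coset_def' op_ring_def)
  then show thesis using that[of S z] by (simp add: add.commute)
qed

end

theory Submission
  imports Defs "HOL-Complex_Analysis.Laurent_Convergence"
begin

text \<open>
  Write \<open>T = z I + S\<close> with \<open>S\<close> strictly singular and let \<open>x\<close> be a vector that witnesses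
  \<open>u\<close>-frequent hypercyclicity; its orbit is dense. The proof has two halves: density of the orbit
  makes \<open>S\<close> quasinilpotent in a weak sense, and for quasinilpotent \<open>S\<close> the orbit returns to a
  suitable ball only along a set of density zero.

  First half. A gauge that \<open>T\<close> multiplies by a constant is monotone along every orbit, so it
  vanishes if one orbit is dense (\<open>eigen_gauge_zero\<close>). Applied to the distance from the range of
  \<open>1 - l S\<close>, this shows that \<open>1 - l S\<close> has dense range for every scalar \<open>l\<close>. As \<open>S\<close> is strictly
  singular, \<open>1 - l S\<close> is bounded below on a subspace of finite codimension
  (\<open>bounded_below_finite_codim\<close>), hence has closed range and is onto. The identity is injective, and
  along a continuous path of surjections injectivity neither appears nor disappears
  (\<open>injective_along_path\<close>); letting \<open>l\<close> run from \<open>0\<close> along a segment, every \<open>1 - l S\<close> is invertible.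
  Hence \<open>l \<mapsto> \<phi> ((1 - l S)\<^sup>-\<^sup>1 y)\<close> is entire, and its Taylor coefficients \<open>\<phi> (S\<^sup>n y)\<close> decay faster
  than every geometric sequence (\<open>resolvent_decay\<close>). Over the reals the same is done with the
  operators \<open>1 - 2 Re l S + \<bar>l\<bar>\<^sup>2 S\<^sup>2\<close> for complex \<open>l\<close>, which factor as \<open>(1 - l S) (1 - cnj l S)\<close> in the
  complexification.

  Second half. If \<open>z = 0\<close> the orbit of \<open>x\<close> tends weakly to \<open>0\<close>. Otherwise \<open>T = z (I + N)\<close> with
  \<open>N = S / z\<close>, and for a functional \<open>\<phi>\<close> the sequence \<open>f n = \<phi> ((I + N)\<^sup>n x) = (\<Sum>k\<le>n. (n choose k) \<phi> (N\<^sup>k x))\<close>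
  has very small differences of high order. There are \<open>\<phi>\<close> and \<open>u\<close> with \<open>\<phi> u = 1\<close> and
  \<open>\<phi> (u + N u) = -1\<close>. Whenever \<open>T\<^sup>n x\<close> is close to \<open>u\<close>, the sequence \<open>f\<close> changes sign from \<open>n\<close> to
  \<open>n + 1\<close>, up to the modulus of \<open>z\<^sup>n\<close> and a scalar of modulus one; compactness of the unit sphere of
  scalars reduces the latter to finitely many functionals. But a sequence that alternates in sign at \<open>m + 1\<close> places
  of \<open>{0..K}\<close> has an \<open>m\<close>-th difference that is at least \<open>2\<^sup>-\<^sup>K\<close> times as large, up to a constant
  (\<open>alternating_large_difference\<close>). If the number of sign changes were proportional to \<open>K\<close> for
  arbitrarily large \<open>K\<close>, this would exceed the bound on the differences
  (\<open>null_density_sign_drops\<close>). So the set of return times has density zero.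
\<close>

section \<open>Bounded functionals\<close>

definition sublinear :: "('a::real_vector \<Rightarrow> real) \<Rightarrow> bool" where
  "sublinear p \<longleftrightarrow> (\<forall>x y. p (x + y) \<le> p x + p y) \<and> (\<forall>t\<ge>0. \<forall>x. p (t *\<^sub>R x) = t * p x)"

text \<open>
  The largest sublinear functional \<open>q\<close> below \<open>p\<close> with \<open>q (- a) \<le> - p a\<close>. A functional that cannot be
  lowered in this way is additive in the direction \<open>a\<close>.
\<close>

definition descend :: "('a::real_vector \<Rightarrow> real) \<Rightarrow> 'a \<Rightarrow> 'a \<Rightarrow> real" where
  "descend p a x = (INF t\<in>{0..}. p (x + t *\<^sub>R a) - t * p a)"

lemma sublinear_zero: "sublinear p \<Longrightarrow> p 0 = 0"
  unfolding sublinear_def by (metis mult_zero_left order_refl scaleR_zero_left)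

lemma sublinear_neg: assumes "sublinear p" shows "- p (- x) \<le> p x"
proof -
  have "p (x + - x) \<le> p x + p (- x)" using assms unfolding sublinear_def by blast
  then show ?thesis using sublinear_zero[OF assms] by simp
qed

lemma descend_bdd:
  assumes p: "sublinear p"
  shows "bdd_below ((\<lambda>t. p (x + t *\<^sub>R a) - t * p a) ` {0..})"
proof (rule bdd_belowI2[where m = "- p (- x)"])
  fix t :: real assume t: "t \<in> {0..}"
  have "t * p a = p (t *\<^sub>R a)" using p t by (simp add: sublinear_def)
  also have "\<dots> = p ((x + t *\<^sub>R a) + (- x))" by simp
  also have "\<dots> \<le> p (x + t *\<^sub>R a) + p (- x)" using p unfolding sublinear_def by blast
  finally show "- p (- x) \<le> p (x + t *\<^sub>R a) - t * p a" by simp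
qed

lemma descend_le:
  assumes "sublinear p" "0 \<le> t"
  shows "descend p a x \<le> p (x + t *\<^sub>R a) - t * p a"
  unfolding descend_def using assms by (intro cINF_lower descend_bdd) auto

lemma descend_greatest:
  assumes "\<And>t. 0 \<le> t \<Longrightarrow> m \<le> p (x + t *\<^sub>R a) - t * p a"
  shows "m \<le> descend p a x"
  unfolding descend_def using assms by (intro cINF_greatest) auto

lemma descend_le_self: "sublinear p \<Longrightarrow> descend p a x \<le> p x"
  using descend_le[of p 0 a x] by simp

lemma sublinear_descend:
  assumes p: "sublinear p"
  shows "sublinear (descend p a)"
  unfolding sublinear_def
proof (intro conjI allI impI)
  have add: "p (u + v) \<le> p u + p v" and scale: "0 \<le> t \<Longrightarrow> p (t *\<^sub>R u) = t * p u" for u v t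
    using p unfolding sublinear_def by blast+
  show "descend p a (x + y) \<le> descend p a x + descend p a y" for x y
  proof -
    have "descend p a (x + y) - descend p a x \<le> p (y + t *\<^sub>R a) - t * p a" if t: "0 \<le> t" for t
    proof -
      have "descend p a (x + y) - (p (y + t *\<^sub>R a) - t * p a) \<le> p (x + s *\<^sub>R a) - s * p a" if s: "0 \<le> s" for s
      proof -
        have "descend p a (x + y) \<le> p ((x + y) + (s + t) *\<^sub>R a) - (s + t) * p a"
          using s t by (intro descend_le p) auto
        also have "(x + y) + (s + t) *\<^sub>R a = (x + s *\<^sub>R a) + (y + t *\<^sub>R a)"
          by (simp add: algebra_simps)
        finally show ?thesis using add[of "x + s *\<^sub>R a" "y + t *\<^sub>R a"] by (simp add: algebra_simps)
      qed
      from descend_greatest[OF this] show ?thesis by simp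
    qed
    from descend_greatest[OF this] show ?thesis by simp
  qed
  have le: "descend p a (t *\<^sub>R x) \<le> t * descend p a x" if t: "0 < t" for t x
  proof -
    have "descend p a (t *\<^sub>R x) / t \<le> p (x + s *\<^sub>R a) - s * p a" if s: "0 \<le> s" for s
    proof -
      have "descend p a (t *\<^sub>R x) \<le> p (t *\<^sub>R x + (t * s) *\<^sub>R a) - (t * s) * p a"
        using s t by (intro descend_le p) auto
      also have "t *\<^sub>R x + (t * s) *\<^sub>R a = t *\<^sub>R (x + s *\<^sub>R a)" by (simp add: algebra_simps)
      finally show ?thesis using t scale[of t "x + s *\<^sub>R a"] by (simp add: field_simps)
    qed
    from descend_greatest[OF this] show ?thesis using t by (simp add: field_simps)
  qed
  show "descend p a (t *\<^sub>R x) = t * descend p a x" if t: "0 \<le> t" for t x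
  proof (cases "t = 0")
    case True
    have "0 \<le> descend p a 0"
      by (intro descend_greatest) (simp add: scale)
    then show ?thesis using True descend_le_self[OF p, of a 0] sublinear_zero[OF p] by simp
  next
    case False
    then have t: "0 < t" using t by simp
    show ?thesis using le[OF t, of x] le[of "1/t" "t *\<^sub>R x"] t by (simp add: field_simps)
  qed
qed

text \<open>
  Zorn's lemma for the reversed pointwise order: the pointwise infimum of a chain is finite because
  \<open>- p (- x)\<close> is a lower bound, and sublinear because any two members of a chain are comparable.
\<close>

lemma minimal_sublinear_exists:
  fixes p :: "'a::real_vector \<Rightarrow> real"
  assumes p: "sublinear p"
  obtains m where "sublinear m" "\<And>x. m x \<le> p x"
    "\<And>m'. sublinear m' \<Longrightarrow> (\<And>x. m' x \<le> m x) \<Longrightarrow> m' = m"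
proof -
  define A where "A = {f. sublinear f \<and> f \<le> p}"
  define P where "P = (\<lambda>f g :: 'a \<Rightarrow> real. g \<le> f)"
  have po: "partial_order_on A (relation_of P A)"
    unfolding partial_order_on_def preorder_on_def refl_on_def trans_def antisym_def relation_of_def P_def
    by auto
  have "\<exists>u\<in>A. \<forall>a\<in>C. P a u" if C: "C \<in> Chains (relation_of P A)" for C
  proof (cases "C = {}")
    case True then show ?thesis using p unfolding A_def by auto
  next
    case False
    have CA: "f \<in> A" if "f \<in> C" for f
      using C that unfolding Chains_def relation_of_def by blast
    have tot: "f \<le> g \<or> g \<le> f" if "f \<in> C" "g \<in> C" for f g
      using C that unfolding Chains_def relation_of_def P_def by blast
    have sub: "sublinear f" and fp: "f x \<le> p x" if "f \<in> C" for f x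
      using CA[OF that] unfolding A_def le_fun_def by auto
    define u where "u x = (INF f\<in>C. f x)" for x
    have bdd: "bdd_below ((\<lambda>f. f x) ` C)" for x
    proof (rule bdd_belowI2[where m = "- p (- x)"])
      fix f assume f: "f \<in> C"
      show "- p (- x) \<le> f x" using sublinear_neg[OF sub[OF f], of x] fp[OF f, of "- x"] by linarith
    qed
    have ule: "u x \<le> f x" if "f \<in> C" for f x
      unfolding u_def using that by (intro cINF_lower bdd)
    have ugr: "r \<le> u x" if "\<And>f. f \<in> C \<Longrightarrow> r \<le> f x" for r x
      unfolding u_def using that False by (intro cINF_greatest)
    have "sublinear u"
      unfolding sublinear_def
    proof (intro conjI allI impI)
      fix x y
      have "u (x + y) - u x \<le> g y" if g: "g \<in> C" for g
      proof -
        have "u (x + y) - g y \<le> f x" if f: "f \<in> C" for f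
        proof -
          obtain h where h: "h \<in> C" "h \<le> f" "h \<le> g" using tot[OF f g] f g by blast
          have "u (x + y) \<le> h x + h y"
            using ule[OF h(1), of "x + y"] sub[OF h(1)] unfolding sublinear_def by (meson order_trans)
          also have "\<dots> \<le> f x + g y" using h by (intro add_mono) (auto simp: le_fun_def)
          finally show ?thesis by simp
        qed
        then have "u (x + y) - g y \<le> u x" by (rule ugr)
        then show ?thesis by simp
      qed
      then have "u (x + y) - u x \<le> u y" by (rule ugr)
      then show "u (x + y) \<le> u x + u y" by simp
    next
      fix t :: real and x assume t: "0 \<le> t"
      have sc: "f (t *\<^sub>R x) = t * f x" if "f \<in> C" for f
        using sub[OF that] t unfolding sublinear_def by blast
      show "u (t *\<^sub>R x) = t * u x"
      proof (cases "t = 0")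
        case True
        obtain f where "f \<in> C" using False by blast
        moreover have "0 \<le> u 0" by (rule ugr) (simp add: sublinear_zero sub)
        ultimately show ?thesis using True ule[of f 0] sublinear_zero[OF sub] by fastforce
      next
        case False
        then have t: "0 < t" using t by simp
        show ?thesis
        proof (rule antisym)
          have "u (t *\<^sub>R x) / t \<le> u x"
            using ule[of _ "t *\<^sub>R x"] sc t by (intro ugr) (simp add: field_simps)
          then show "u (t *\<^sub>R x) \<le> t * u x" using t by (simp add: field_simps)
          show "t * u x \<le> u (t *\<^sub>R x)"
          proof (rule ugr)
            show "t * u x \<le> f (t *\<^sub>R x)" if "f \<in> C" for f
              unfolding sc[OF that] using ule[OF that, of x] t by (intro mult_left_mono) auto
          qed
        qed
      qed
    qed
    moreover have "u \<le> p"
    proof -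
      obtain f where "f \<in> C" using False by blast
      then show ?thesis using ule fp unfolding le_fun_def by (meson order_trans)
    qed
    ultimately have "u \<in> A" unfolding A_def by blast
    then show ?thesis using ule unfolding P_def le_fun_def by blast
  qed
  from predicate_Zorn[OF po this] obtain m where m: "m \<in> A" "\<forall>a\<in>A. P m a \<longrightarrow> a = m" by blast
  show thesis
  proof (rule that[of m])
    show "sublinear m" "m x \<le> p x" for x using m(1) unfolding A_def le_fun_def by auto
    show "m' = m" if m': "sublinear m'" "\<And>x. m' x \<le> m x" for m'
    proof -
      have le: "m' \<le> m" using m'(2) by (simp add: le_fun_def)
      then have "m' \<in> A" using m'(1) m(1) unfolding A_def by (auto intro: order_trans)
      then show ?thesis using m(2) le unfolding P_def by blast
    qed
  qed
qed

text \<open>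
  Minimality forces \<open>descend m a = m\<close> for every \<open>a\<close>, which is the missing inequality
  \<open>m x + m a \<le> m (x + a)\<close>.
\<close>

lemma minimal_sublinear_linear:
  fixes m :: "'a::real_vector \<Rightarrow> real"
  assumes m: "sublinear m"
    and min: "\<And>m'. sublinear m' \<Longrightarrow> (\<And>x. m' x \<le> m x) \<Longrightarrow> m' = m"
  shows "linear m"
proof -
  have le: "m (x + y) \<le> m x + m y" and scale: "0 \<le> t \<Longrightarrow> m (t *\<^sub>R x) = t * m x" for x y t
    using m unfolding sublinear_def by blast+
  have add: "m (x + a) = m x + m a" for x a
  proof -
    have "descend m a = m" by (intro min sublinear_descend descend_le_self m)
    then have "m x \<le> m (x + 1 *\<^sub>R a) - 1 * m a" using descend_le[OF m, of 1 a x] by simp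
    then show ?thesis using le[of x a] by simp
  qed
  have neg: "m (- x) = - m x" for x
    using add[of x "- x"] sublinear_zero[OF m] by simp
  show ?thesis
  proof (rule linearI)
    show "m (x + y) = m x + m y" for x y by (rule add)
    show "m (r *\<^sub>R x) = r *\<^sub>R m x" for r x
    proof (cases "0 \<le> r")
      case False
      have "m (r *\<^sub>R x) = - m ((- r) *\<^sub>R x)" using neg[of "(- r) *\<^sub>R x"] by simp
      then show ?thesis using scale[of "- r" x] False by simp
    qed (simp add: scale)
  qed
qed

text \<open>
  The functional is obtained as a minimal sublinear functional below \<open>descend q a\<close>: descending once
  in the direction \<open>a\<close> beforehand makes the value at \<open>a\<close> equal to \<open>q a\<close>.
\<close>

theorem Hahn_Banach_seminorm:
  fixes q :: "'a::real_vector \<Rightarrow> real"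
  assumes q: "sublinear q" and sym: "\<And>x. q (- x) = q x"
  obtains \<phi> where "linear \<phi>" "\<And>x. \<bar>\<phi> x\<bar> \<le> q x" "\<phi> a = q a"
proof -
  obtain m where m: "sublinear m" "\<And>x. m x \<le> descend q a x"
    "\<And>m'. sublinear m' \<Longrightarrow> (\<And>x. m' x \<le> m x) \<Longrightarrow> m' = m"
    using minimal_sublinear_exists[OF sublinear_descend[OF q]] by metis
  have lin: "linear m" by (rule minimal_sublinear_linear[OF m(1,3)])
  have mq: "m x \<le> q x" for x using m(2)[of x] descend_le_self[OF q, of a x] by linarith
  have neg: "m (- x) = - m x" for x by (rule linear_neg[OF lin])
  show thesis
  proof (rule that[OF lin])
    show "\<bar>m x\<bar> \<le> q x" for x using mq[of x] mq[of "- x"] neg[of x] sym[of x] by linarith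
    have "m (- a) \<le> - q a"
      using m(2)[of "- a"] descend_le[OF q, of 1 a "- a"] sublinear_zero[OF q] by simp
    then show "m a = q a" using mq[of a] neg[of a] by linarith
  qed
qed

corollary norming_functional:
  fixes a :: "'a::real_normed_vector"
  obtains \<phi> :: "'a \<Rightarrow> real" where "bounded_linear \<phi>" "\<And>x. \<bar>\<phi> x\<bar> \<le> norm x" "\<phi> a = norm a"
proof -
  have "sublinear (norm :: 'a \<Rightarrow> real)" by (simp add: sublinear_def norm_triangle_ineq)
  then obtain \<phi> :: "'a \<Rightarrow> real" where \<phi>: "linear \<phi>" "\<And>x. \<bar>\<phi> x\<bar> \<le> norm x" "\<phi> a = norm a"
    by (rule Hahn_Banach_seminorm) auto
  show thesis
    by (rule that[OF _ \<phi>(2,3)], rule bounded_linear_intro[where K = 1])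
      (use \<phi> in \<open>auto simp: linear_add linear_scale\<close>)
qed

lemma infdist_subspace_add:
  fixes M :: "'a::real_normed_vector set"
  assumes M: "subspace M" and v: "v \<in> M"
  shows "infdist (x + v) M = infdist x M"
proof -
  have le: "infdist (x + v) M \<le> infdist x M" if v: "v \<in> M" for x v
  proof -
    have "infdist (x + v) M \<le> dist x m" if m: "m \<in> M" for m
      using infdist_le[of "m + v" M "x + v"] subspace_add[OF M m v] by (simp add: dist_norm)
    then show ?thesis using v by (subst infdist_notempty[of M x]) (auto intro!: cINF_greatest)
  qed
  show ?thesis using le[OF v, of x] le[of "- v" "x + v"] M v by (auto simp: subspace_neg)
qed

lemma infdist_subspace_triangle:
  fixes M :: "'a::real_normed_vector set"
  assumes M: "subspace M"
  shows "infdist (x + y) M \<le> infdist x M + infdist y M"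
proof -
  have ne: "M \<noteq> {}" using subspace_0[OF M] by blast
  have "infdist (x + y) M - infdist y M \<le> dist x m" if m: "m \<in> M" for m
  proof -
    have "infdist (x + y) M - dist x m \<le> dist y n" if n: "n \<in> M" for n
    proof -
      have "infdist (x + y) M \<le> dist (x + y) (m + n)" using subspace_add[OF M m n] by (rule infdist_le)
      also have "\<dots> \<le> dist x m + dist y n" by (rule dist_triangle_add)
      finally show ?thesis by simp
    qed
    then have "infdist (x + y) M - dist x m \<le> infdist y M"
      using ne by (subst infdist_notempty[of M y]) (auto intro!: cINF_greatest)
    then show ?thesis by simp
  qed
  then have "infdist (x + y) M - infdist y M \<le> infdist x M"
    using ne by (subst (3) infdist_notempty) (auto intro!: cINF_greatest)
  then show ?thesis by simp
qed

text \<open>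
  Stated for a map \<open>h\<close> rather than a scalar, so that it covers real and complex multiples alike.
\<close>

lemma infdist_image_scale:
  fixes h :: "'a::real_normed_vector \<Rightarrow> 'a"
  assumes M: "M \<noteq> {}" and sub: "h ` M \<subseteq> M" and sur: "M \<subseteq> h ` M"
    and h: "\<And>u v. norm (h u - h v) = c * norm (u - v)" and c: "0 \<le> c"
  shows "infdist (h x) M = c * infdist x M"
proof (cases "c = 0")
  case True
  have eq: "h x = h v" for v using h[of x v] True by simp
  obtain m where "m \<in> M" using M by blast
  then have "h x \<in> M" using eq[of m] sub by auto
  then show ?thesis using True by simp
next
  case False
  then have c: "0 < c" using c by simp
  show ?thesis
  proof (rule antisym)
    have "infdist (h x) M / c \<le> dist x m" if "m \<in> M" for m
      using infdist_le[of "h m" M "h x"] that sub h[of x m] c by (auto simp: field_simps dist_norm)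
    then have "infdist (h x) M / c \<le> infdist x M"
      using M by (subst (2) infdist_notempty) (auto intro!: cINF_greatest)
    then show "infdist (h x) M \<le> c * infdist x M" using c by (simp add: field_simps)
    have "c * infdist x M \<le> dist (h x) m" if m: "m \<in> M" for m
    proof -
      obtain m' where "m' \<in> M" "m = h m'" using subsetD[OF sur m] by blast
      then show ?thesis using infdist_le[of m' M x] h[of x m'] c by (simp add: dist_norm)
    qed
    then show "c * infdist x M \<le> infdist (h x) M"
      using M by (subst (2) infdist_notempty) (auto intro!: cINF_greatest)
  qed
qed

corollary annihilating_functional:
  fixes M :: "'a::real_normed_vector set"
  assumes M: "subspace M" and a: "a \<notin> closure M"
  obtains \<phi> :: "'a \<Rightarrow> real" where "bounded_linear \<phi>" "\<And>x. x \<in> M \<Longrightarrow> \<phi> x = 0" "\<phi> a \<noteq> 0"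
proof -
  have ne: "M \<noteq> {}" using subspace_0[OF M] by blast
  have img: "(\<lambda>x. t *\<^sub>R x) ` M = M" if "t \<noteq> 0" for t :: real
  proof
    show "(\<lambda>x. t *\<^sub>R x) ` M \<subseteq> M" using M by (auto simp: subspace_scale)
    show "M \<subseteq> (\<lambda>x. t *\<^sub>R x) ` M"
    proof
      fix x assume "x \<in> M"
      then have "(1/t) *\<^sub>R x \<in> M" using M by (simp add: subspace_scale)
      then show "x \<in> (\<lambda>x. t *\<^sub>R x) ` M" using that by (intro image_eqI[of _ _ "(1/t) *\<^sub>R x"]) auto
    qed
  qed
  have scale: "infdist (t *\<^sub>R x) M = \<bar>t\<bar> * infdist x M" for t x
  proof (cases "t = 0")
    case True then show ?thesis using subspace_0[OF M] by simp
  next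
    case False
    show ?thesis using img[OF False] ne
      by (intro infdist_image_scale) (auto simp: scaleR_diff_right[symmetric])
  qed
  have "sublinear (\<lambda>x. infdist x M)"
    by (auto simp: sublinear_def infdist_subspace_triangle[OF M] scale)
  then obtain \<phi> where \<phi>: "linear \<phi>" "\<And>x. \<bar>\<phi> x\<bar> \<le> infdist x M" "\<phi> a = infdist a M"
    by (rule Hahn_Banach_seminorm[where a = a]) (use scale[of "-1"] in auto)
  show thesis
  proof (rule that)
    have "infdist x M \<le> norm x" for x
      using infdist_le[OF subspace_0[OF M], of x] by simp
    then show "bounded_linear \<phi>"
      using \<phi> by (intro bounded_linear_intro[where K = 1])
        (auto simp: linear_add linear_scale intro: order_trans)
    show "\<phi> x = 0" if "x \<in> M" for x using \<phi>(2)[of x] that by simp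
    show "\<phi> a \<noteq> 0" using \<phi>(3) a ne by (simp add: in_closure_iff_infdist_zero)
  qed
qed

section \<open>Finite differences of alternating sequences\<close>

definition fdiff :: "(nat \<Rightarrow> real) \<Rightarrow> nat \<Rightarrow> real" where
  "fdiff f n = f (Suc n) - f n"

lemma fdiff_pow_diff: "(fdiff ^^ m) (\<lambda>n. f n - c * g n) n = (fdiff ^^ m) f n - c * (fdiff ^^ m) g n"
  by (induction m arbitrary: n) (auto simp: fdiff_def algebra_simps)

lemma fdiff_pow_binomial: "(fdiff ^^ m) (\<lambda>n. real (n choose m)) = (\<lambda>n. 1)"
proof (induction m)
  case (Suc m)
  have "fdiff (\<lambda>n. real (n choose Suc m)) = (\<lambda>n. real (n choose m))"
    by (auto simp: fdiff_def)
  then show ?case using Suc by (simp add: funpow_Suc_right del: funpow.simps)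
qed auto

lemma increase_somewhere:
  fixes g :: "nat \<Rightarrow> real"
  assumes "a < b" "g a < g b"
  obtains n where "a \<le> n" "n < b" "g n < g (Suc n)"
proof (rule ccontr)
  assume "\<not> thesis"
  then have dec: "g (Suc n) \<le> g n" if "a \<le> n" "n < b" for n
    using that(1,2) \<open>\<And>n. a \<le> n \<Longrightarrow> n < b \<Longrightarrow> g n < g (Suc n) \<Longrightarrow> thesis\<close> by force
  have "b' \<le> b \<Longrightarrow> g b' \<le> g a" if "a \<le> b'" for b'
    using that by (induction b' rule: dec_induct) (use dec in force)+
  then show False using assms by (meson less_imp_le not_le order_refl)
qed

text \<open>
  Between two consecutive places of the alternation the difference somewhere takes the sign of the later value, so each
  application of \<^const>\<open>fdiff\<close> costs one alternation.
\<close>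

lemma discrete_Rolle:
  assumes "\<And>i. i < m \<Longrightarrow> s i < s (Suc i)" "\<And>i. i \<le> m \<Longrightarrow> 0 < (-1) ^ i * f (s i)"
  obtains n where "n \<le> s m" "0 < (-1) ^ m * (fdiff ^^ m) f n"
  using assms
proof (induction m arbitrary: f s thesis)
  case 0
  then show ?case by (metis funpow_0 le_refl)
next
  case (Suc m)
  have "\<exists>n. s i \<le> n \<and> n < s (Suc i) \<and> 0 < (-1) ^ i * - fdiff f n" if i: "i \<le> m" for i
  proof -
    have "(-1) ^ Suc i * f (s i) < (-1) ^ Suc i * f (s (Suc i))"
      using Suc.prems(3)[of i] Suc.prems(3)[of "Suc i"] i by simp
    from increase_somewhere[of "s i" "s (Suc i)" "\<lambda>n. (-1) ^ Suc i * f n", OF Suc.prems(2) this] i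
    show ?thesis by (force simp: fdiff_def algebra_simps)
  qed
  then obtain t where t: "\<And>i. i \<le> m \<Longrightarrow> s i \<le> t i \<and> t i < s (Suc i) \<and> 0 < (-1) ^ i * - fdiff f (t i)"
    by metis
  have inc: "t i < t (Suc i)" if "i < m" for i using t[of i] t[of "Suc i"] that by force
  obtain n where n: "n \<le> t m" "0 < (-1) ^ m * (fdiff ^^ m) (\<lambda>n. - fdiff f n) n"
    using Suc.IH[of t "\<lambda>n. - fdiff f n"] inc t by blast
  have "(fdiff ^^ m) (\<lambda>n. - fdiff f n) n = - (fdiff ^^ m) (fdiff f) n"
    using fdiff_pow_diff[of m "\<lambda>n. 0" 1 "fdiff f" n] fdiff_pow_diff[of m "\<lambda>n. 0" 1 "\<lambda>n. 0" n] by simp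
  then have "0 < (-1) ^ Suc m * (fdiff ^^ Suc m) f n"
    using n by (simp add: funpow_Suc_right del: funpow.simps)
  moreover have "n \<le> s (Suc m)" using n t[of m] by simp
  ultimately show ?case using Suc.prems(1) by blast
qed

text \<open>
  If all differences of order \<open>m\<close> were small, subtracting a small multiple of \<open>n choose m\<close>, whose
  \<open>m\<close>-th difference is constant, would preserve the alternation but make the \<open>m\<close>-th difference of
  the wrong sign. The factor \<open>2 ^ K\<close> is a bound for \<open>n choose m\<close> on \<open>{0..K}\<close>.
\<close>

lemma alternating_large_difference:
  assumes s: "\<And>i. i < m \<Longrightarrow> s i < s (Suc i)" and K: "s m \<le> K"
    and \<eta>: "0 < \<eta>" and f: "\<And>i. i \<le> m \<Longrightarrow> \<eta> \<le> (-1) ^ i * f (s i)"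
  obtains n where "n \<le> K" "\<eta> / 2 ^ Suc K \<le> \<bar>(fdiff ^^ m) f n\<bar>"
proof -
  \<comment> \<open>The sign makes \<open>(-1) ^ m * c\<close> equal to the positive number \<open>\<eta> / 2 ^ Suc K\<close>.\<close>
  define c where "c = (-1) ^ m * (\<eta> / 2 ^ Suc K)"
  have sK: "s i \<le> K" if "i \<le> m" for i
    using that K by (induction i rule: inc_induct) (use s in \<open>auto intro: order_trans less_imp_le\<close>)
  have "0 < (-1) ^ i * (f (s i) - c * real (s i choose m))" if i: "i \<le> m" for i
  proof -
    have "real (s i choose m) \<le> 2 ^ K"
    proof -
      have "s i choose m \<le> 2 ^ s i"
        by (metis binomial_eq_0 binomial_le_pow2 le_cases not_le zero_le)
      also have "\<dots> \<le> 2 ^ K" using sK[OF i] by simp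
      finally show ?thesis by (metis numeral_power_le_of_nat_cancel_iff of_nat_le_iff of_nat_numeral of_nat_power)
    qed
    then have "\<bar>c * real (s i choose m)\<bar> \<le> \<eta> / 2 ^ Suc K * 2 ^ K"
      using \<eta> unfolding c_def abs_mult by (intro mult_mono) (auto simp: power_abs)
    then have "\<bar>(-1) ^ i * (c * real (s i choose m))\<bar> \<le> \<eta> / 2" by (simp add: abs_mult power_abs)
    then show ?thesis using f[OF i] \<eta> by (simp only: right_diff_distrib)
  qed
  with s obtain n where n: "n \<le> s m"
      "0 < (-1) ^ m * (fdiff ^^ m) (\<lambda>n. f n - c * real (n choose m)) n"
    using discrete_Rolle[of m s "\<lambda>n. f n - c * real (n choose m)"] by blast
  then have "0 < (-1) ^ m * (fdiff ^^ m) f n - (-1) ^ m * c"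
    by (simp add: fdiff_pow_diff fdiff_pow_binomial right_diff_distrib)
  then have "(-1) ^ m * c < (-1) ^ m * (fdiff ^^ m) f n" by simp
  also have "\<dots> \<le> \<bar>(-1) ^ m * (fdiff ^^ m) f n\<bar>" by (rule abs_ge_self)
  also have "\<dots> = \<bar>(fdiff ^^ m) f n\<bar>" by (simp add: abs_mult power_abs)
  finally have "\<eta> / 2 ^ Suc K \<le> \<bar>(fdiff ^^ m) f n\<bar>"
    unfolding c_def left_minus_one_mult_self by simp
  then show thesis using that n K by (meson order_trans)
qed

section \<open>Density of sign changes\<close>

text \<open>
  The sequence whose forward differences at \<open>0\<close> are \<open>a\<close> (Newton interpolation).
\<close>

definition newton :: "(nat \<Rightarrow> real) \<Rightarrow> nat \<Rightarrow> real" where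
  "newton a n = (\<Sum>k\<le>n. real (n choose k) * a k)"

lemma newton_0 [simp]: "newton a 0 = a 0"
  by (simp add: newton_def)

lemma newton_Suc: "newton a (Suc n) = newton a n + newton (\<lambda>k. a (Suc k)) n"
proof -
  have "newton a (Suc n) = a 0 + (\<Sum>k\<le>n. real (Suc n choose Suc k) * a (Suc k))"
    unfolding newton_def by (subst sum.atMost_Suc_shift) simp
  also have "\<dots> = (a 0 + (\<Sum>k\<le>n. real (n choose Suc k) * a (Suc k))) + newton (\<lambda>k. a (Suc k)) n"
    by (simp add: newton_def sum.distrib[symmetric] algebra_simps)
  also have "a 0 + (\<Sum>k\<le>n. real (n choose Suc k) * a (Suc k)) = (\<Sum>k\<le>Suc n. real (n choose k) * a k)"
    by (subst sum.atMost_Suc_shift) simp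
  also have "\<dots> = newton a n" by (simp add: newton_def)
  finally show ?thesis .
qed

lemma fdiff_pow_newton: "(fdiff ^^ m) (newton a) = newton (\<lambda>k. a (m + k))"
proof (induction m arbitrary: a)
  case (Suc m)
  have "fdiff (newton a) = newton (\<lambda>k. a (Suc k))" by (auto simp: fdiff_def newton_Suc)
  then show ?case using Suc[of "\<lambda>k. a (Suc k)"] by (simp add: funpow_Suc_right del: funpow.simps)
qed auto

definition rapidly_decaying :: "(nat \<Rightarrow> real) \<Rightarrow> bool" where
  "rapidly_decaying a \<longleftrightarrow> (\<forall>\<epsilon>>0. \<exists>C. \<forall>k. \<bar>a k\<bar> \<le> C * \<epsilon> ^ k)"

lemma fdiff_pow_newton_le:
  assumes a: "\<And>k. \<bar>a k\<bar> \<le> C * \<epsilon> ^ k" and \<epsilon>: "0 \<le> \<epsilon>"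
  shows "\<bar>(fdiff ^^ m) (newton a) n\<bar> \<le> C * \<epsilon> ^ m * (1 + \<epsilon>) ^ n"
proof -
  have "\<bar>(fdiff ^^ m) (newton a) n\<bar> \<le> (\<Sum>k\<le>n. \<bar>real (n choose k) * a (m + k)\<bar>)"
    unfolding fdiff_pow_newton newton_def by (rule sum_abs)
  also have "\<dots> \<le> (\<Sum>k\<le>n. real (n choose k) * (C * \<epsilon> ^ (m + k)))"
    by (intro sum_mono) (auto simp: abs_mult intro!: mult_left_mono a)
  also have "\<dots> = C * \<epsilon> ^ m * (\<Sum>k\<le>n. real (n choose k) * \<epsilon> ^ k * 1 ^ (n - k))"
    by (simp add: sum_distrib_left power_add algebra_simps)
  also have "\<dots> = C * \<epsilon> ^ m * (1 + \<epsilon>) ^ n"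
    by (simp only: binomial_ring[symmetric] of_nat_id add.commute)
  finally show ?thesis .
qed

text \<open>
  The threshold is geometric because the functional is applied to \<open>T\<^sup>n x\<close> divided by \<open>z\<^sup>n\<close>; then
  \<open>r\<close> is the reciprocal of the modulus of \<open>z\<close>.
\<close>

definition sign_drops :: "real \<Rightarrow> real \<Rightarrow> (nat \<Rightarrow> real) \<Rightarrow> nat set" where
  "sign_drops \<delta> r f = {n. \<delta> * r ^ n \<le> f n \<and> f (Suc n) \<le> - (\<delta> * r ^ n)}"

text \<open>
  Each sign drop contributes the two points \<open>n\<close> and \<open>n + 1\<close> to an alternating sequence of length
  \<open>2 M\<close>, so \<open>alternating_large_difference\<close> applies with order \<open>2 M - 1\<close>.
\<close>

lemma sign_drops_count:
  assumes a: "\<And>k. \<bar>a k\<bar> \<le> C * \<epsilon> ^ k" and \<epsilon>: "0 < \<epsilon>" "\<epsilon> \<le> 1"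
    and \<delta>: "0 < \<delta>" and r: "0 < r" "r \<le> 1"
    and M: "M = card {n \<in> sign_drops \<delta> r (newton a). n \<le> K}" "0 < M"
  shows "\<delta> \<le> 2 * C * \<epsilon> ^ M * (4 / r) ^ Suc K"
proof -
  let ?f = "newton a" and ?B = "{n \<in> sign_drops \<delta> r (newton a). n \<le> K}"
  have fin: "finite ?B" by simp
  obtain e where e: "bij_betw e {..<M} ?B" "strict_mono_on {..<M} e"
    using ex_bij_betw_strict_mono_card[OF fin] M by metis
  have eB: "e i \<in> ?B" if "i < M" for i using e(1) that by (auto simp: bij_betw_def)
  define \<eta> where "\<eta> = \<delta> * r ^ Suc K"
  have \<eta>: "0 < \<eta>" using \<delta> r by (simp add: \<eta>_def)
  have \<eta>le: "\<eta> \<le> \<delta> * r ^ e i" if "i < M" for i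
    unfolding \<eta>_def using eB[OF that] r \<delta> by (intro mult_left_mono power_decreasing) auto
  have pos: "\<eta> \<le> ?f (e i)" and neg: "\<eta> \<le> - ?f (Suc (e i))" if "i < M" for i
    using eB[OF that] \<eta>le[OF that] by (auto simp: sign_drops_def)
  \<comment> \<open>The points \<open>e 0, e 0 + 1, e 1, e 1 + 1, ...\<close>; consecutive drops do not overlap because the signs at \<open>e i + 1\<close> and \<open>e (i + 1)\<close> differ.\<close>
  define s where "s i = e (i div 2) + i mod 2" for i
  define m where "m = 2 * M - 1"
  have div: "i div 2 < M" if "i \<le> m" for i using that M(2) unfolding m_def by linarith
  have "s i < s (Suc i)" if "i < m" for i
  proof (cases "even i")
    case True
    then show ?thesis by (auto simp: s_def elim: evenE)
  next
    case False
    then have d: "Suc i div 2 = Suc (i div 2)" by simp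
    have j: "Suc (i div 2) < M" using div[of "Suc i"] that d by simp
    have "e (i div 2) < e (Suc (i div 2))"
      using e(2) j by (auto simp: strict_mono_on_def)
    moreover have "Suc (e (i div 2)) \<noteq> e (Suc (i div 2))"
    proof
      assume "Suc (e (i div 2)) = e (Suc (i div 2))"
      then show False using neg[of "i div 2"] pos[of "Suc (i div 2)"] j \<eta> by simp
    qed
    ultimately have "Suc (e (i div 2)) < e (Suc (i div 2))" by simp
    then show ?thesis using False d by (simp add: s_def odd_iff_mod_2_eq_one)
  qed
  moreover have "\<eta> \<le> (-1) ^ i * ?f (s i)" if "i \<le> m" for i
    using pos[OF div[OF that]] neg[OF div[OF that]]
    by (cases "even i") (auto simp: s_def odd_iff_mod_2_eq_one)
  moreover have "s m \<le> Suc K"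
    using eB[OF div[of m]] by (auto simp: s_def intro: add_le_mono[of _ K _ 1, simplified])
  ultimately obtain n where n: "n \<le> Suc K" "\<eta> / 2 ^ Suc (Suc K) \<le> \<bar>(fdiff ^^ m) ?f n\<bar>"
    using alternating_large_difference[of m s "Suc K" \<eta> ?f] \<eta> by metis
  have C: "0 \<le> C" using a[of 0] by simp
  note n(2)
  also have "\<bar>(fdiff ^^ m) ?f n\<bar> \<le> C * \<epsilon> ^ m * (1 + \<epsilon>) ^ n"
    using a \<epsilon> by (intro fdiff_pow_newton_le) auto
  also have "\<dots> \<le> C * \<epsilon> ^ M * 2 ^ Suc K"
  proof (intro mult_mono)
    show "\<epsilon> ^ m \<le> \<epsilon> ^ M" using \<epsilon> M(2) by (intro power_decreasing) (auto simp: m_def)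
    have "(1 + \<epsilon>) ^ n \<le> 2 ^ n" using \<epsilon> by (intro power_mono) auto
    also have "\<dots> \<le> 2 ^ Suc K" using n by (intro power_increasing) auto
    finally show "(1 + \<epsilon>) ^ n \<le> 2 ^ Suc K" .
  qed (use C \<epsilon> in auto)
  finally have "\<eta> \<le> 2 * (C * \<epsilon> ^ M * (2 ^ Suc K * 2 ^ Suc K))" by (simp add: field_simps)
  also have "(2::real) ^ Suc K * 2 ^ Suc K = 4 ^ Suc K" by (simp only: power_mult_distrib[symmetric]) simp
  finally have "\<delta> \<le> 2 * (C * \<epsilon> ^ M * 4 ^ Suc K) / r ^ Suc K"
    unfolding \<eta>_def using r by (subst pos_le_divide_eq) auto
  then show ?thesis by (simp add: power_divide)
qed

lemma sign_drops_mono_ratio: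
  assumes "r' \<le> r" "0 < r'" "0 < \<delta>" shows "sign_drops \<delta> r f \<subseteq> sign_drops \<delta> r' f"
proof
  fix n assume "n \<in> sign_drops \<delta> r f"
  moreover have "\<delta> * r' ^ n \<le> \<delta> * r ^ n" using assms by (intro mult_left_mono power_mono) auto
  ultimately show "n \<in> sign_drops \<delta> r' f" unfolding sign_drops_def by auto
qed

definition null_density :: "nat set \<Rightarrow> bool" where
  "null_density A \<longleftrightarrow> (\<lambda>n. real (card {m \<in> A. m \<le> n}) / real n) \<longlonglongrightarrow> 0"

text \<open>
  Sign drops whose number is at least \<open>c K\<close> cannot occur for large \<open>K\<close>: in \<open>sign_drops_count\<close> the
  factor \<open>(4 / r) ^ Suc K\<close> is then at most \<open>L ^ M\<close> for a constant \<open>L\<close>, and \<open>\<epsilon>\<close> is chosen after \<open>L\<close>.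
\<close>

lemma null_density_sign_drops:
  assumes a: "rapidly_decaying a" and \<delta>: "0 < \<delta>" and r0: "0 < r0"
  shows "null_density (sign_drops \<delta> r0 (newton a))"
  unfolding null_density_def
proof (rule LIMSEQ_I)
  fix c :: real assume c: "0 < c"
  let ?A = "sign_drops \<delta> r0 (newton a)"
  \<comment> \<open>With \<open>r \<le> 1\<close> the thresholds \<open>\<delta> * r ^ n\<close> for \<open>n \<le> K\<close> are all at least \<open>\<delta> * r ^ Suc K\<close>.\<close>
  define r where "r = min 1 r0"
  have r: "0 < r" "r \<le> 1" "r \<le> r0" using r0 by (auto simp: r_def)
  \<comment> \<open>If \<open>M \<ge> c K\<close> and \<open>K \<ge> 1\<close> then \<open>Suc K \<le> D M\<close>.\<close>
  define D where "D = nat \<lceil>2 / c\<rceil>"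
  have D: "2 / c \<le> real D" unfolding D_def by linarith
  define L where "L = (4 / r) ^ D"
  have r4: "1 \<le> 4 / r" using r by (simp add: field_simps)
  have L: "1 \<le> L" unfolding L_def using r4 by (rule one_le_power)
  obtain C where C: "\<And>k. \<bar>a k\<bar> \<le> C * (1 / (2 * L)) ^ k"
    using a L unfolding rapidly_decaying_def by (metis divide_pos_pos less_le_trans mult_pos_pos zero_less_numeral zero_less_one)
  have C0: "0 \<le> C" using C[of 0] by simp
  have "(\<lambda>M. 2 * C * (1/2) ^ M) \<longlonglongrightarrow> 2 * C * 0" by (intro tendsto_intros) auto
  then have "eventually (\<lambda>M. 2 * C * (1/2) ^ M < \<delta>) sequentially"
    using \<delta> by (intro order_tendstoD(2)) auto
  then obtain M0 where M0: "\<And>M. M \<ge> M0 \<Longrightarrow> 2 * C * (1/2) ^ M < \<delta>"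
    unfolding eventually_sequentially by blast
  \<comment> \<open>Large enough to force \<open>M > M0\<close> whenever \<open>M \<ge> c K\<close>.\<close>
  define K0 where "K0 = nat \<lceil>real (Suc M0) / c\<rceil> + 1"
  show "\<exists>K0. \<forall>K\<ge>K0. norm (real (card {m \<in> ?A. m \<le> K}) / real K - 0) < c"
  proof (intro exI allI impI)
    fix K assume K: "K0 \<le> K"
    have K1: "1 \<le> K" using K by (simp add: K0_def)
    have KM: "real (Suc M0) \<le> c * real K"
    proof -
      have "real (Suc M0) / c \<le> real K" using K unfolding K0_def by linarith
      then show ?thesis using c by (simp add: field_simps)
    qed
    define M where "M = card {n \<in> sign_drops \<delta> r (newton a). n \<le> K}"
    have "card {m \<in> ?A. m \<le> K} \<le> M"
      unfolding M_def using sign_drops_mono_ratio[OF r(3,1) \<delta>, of "newton a"]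
      by (intro card_mono) auto
    moreover have "real M < c * real K"
    proof (rule ccontr)
      assume "\<not> ?thesis"
      then have MK: "c * real K \<le> real M" by simp
      have MM: "M0 < M" using KM MK by simp
      have "real (Suc K) \<le> 2 * real K" using K1 by simp
      also have "\<dots> \<le> (2 / c) * real M" using MK c by (simp add: field_simps)
      also have "\<dots> \<le> real D * real M" using D by (intro mult_right_mono) auto
      finally have "Suc K \<le> D * M" by (metis of_nat_le_iff of_nat_mult)
      then have "(4 / r) ^ Suc K \<le> L ^ M"
        unfolding L_def power_mult[symmetric] using r4 by (rule power_increasing)
      moreover have "\<delta> \<le> 2 * C * (1 / (2 * L)) ^ M * (4 / r) ^ Suc K"
        using MM L by (intro sign_drops_count[OF C _ _ \<delta> r(1,2) M_def]) (auto simp: field_simps)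
      ultimately have "\<delta> \<le> 2 * C * (1 / (2 * L)) ^ M * L ^ M"
        using C0 L by (smt (verit, best) mult_left_mono mult_nonneg_nonneg zero_le_power divide_nonneg_nonneg)
      also have "\<dots> = 2 * C * (1 / 2) ^ M"
        using L by (simp add: power_divide power_mult_distrib)
      finally show False using M0[of M] MM by simp
    qed
    ultimately have "real (card {m \<in> ?A. m \<le> K}) < c * real K" by linarith
    then show "norm (real (card {m \<in> ?A. m \<le> K}) / real K - 0) < c"
      using K1 by (simp add: divide_less_eq)
  qed
qed

lemma null_density_subset:
  assumes "null_density B" "A \<subseteq> B"
  shows "null_density A"
  unfolding null_density_def
proof (rule tendsto_sandwich[OF _ _ tendsto_const assms(1)[unfolded null_density_def]])
  show "\<forall>\<^sub>F n in sequentially. real (card {m \<in> A. m \<le> n}) / real n \<le> real (card {m \<in> B. m \<le> n}) / real n"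
    using assms(2) by (intro always_eventually allI divide_right_mono) (auto intro!: card_mono)
qed auto

lemma null_density_Un:
  assumes "null_density A" "null_density B"
  shows "null_density (A \<union> B)"
  unfolding null_density_def
proof (rule tendsto_sandwich[OF _ _ tendsto_const])
  have "(\<lambda>n. real (card {m \<in> A. m \<le> n}) / real n + real (card {m \<in> B. m \<le> n}) / real n) \<longlonglongrightarrow> 0 + 0"
    using assms unfolding null_density_def by (rule tendsto_add)
  then show "(\<lambda>n. real (card {m \<in> A. m \<le> n}) / real n + real (card {m \<in> B. m \<le> n}) / real n) \<longlonglongrightarrow> 0"
    by simp
  show "\<forall>\<^sub>F n in sequentially. real (card {m \<in> A \<union> B. m \<le> n}) / real n
      \<le> real (card {m \<in> A. m \<le> n}) / real n + real (card {m \<in> B. m \<le> n}) / real n"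
  proof (intro always_eventually allI)
    fix n
    have "{m \<in> A \<union> B. m \<le> n} = {m \<in> A. m \<le> n} \<union> {m \<in> B. m \<le> n}" by auto
    then have "card {m \<in> A \<union> B. m \<le> n} \<le> card {m \<in> A. m \<le> n} + card {m \<in> B. m \<le> n}"
      by (simp add: card_Un_le)
    then have "real (card {m \<in> A \<union> B. m \<le> n}) \<le> real (card {m \<in> A. m \<le> n}) + real (card {m \<in> B. m \<le> n})"
      by linarith
    then show "real (card {m \<in> A \<union> B. m \<le> n}) / real n
      \<le> real (card {m \<in> A. m \<le> n}) / real n + real (card {m \<in> B. m \<le> n}) / real n"
      unfolding add_divide_distrib[symmetric] by (intro divide_right_mono) auto
  qed
qed auto

lemma null_density_UN:
  assumes "finite I" "\<And>i. i \<in> I \<Longrightarrow> null_density (A i)"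
  shows "null_density (\<Union>i\<in>I. A i)"
  using assms
proof (induction I rule: finite_induct)
  case empty
  show ?case by (simp add: null_density_def)
qed (simp add: null_density_Un)

lemma upper_density_null: "null_density A \<Longrightarrow> upper_density A = 0"
  unfolding null_density_def upper_density_def
  by (intro lim_imp_Limsup) (auto simp: zero_ereal_def)

section \<open>Operators with an everywhere defined resolvent\<close>

text \<open>
  The function \<open>l \<mapsto> \<phi> ((1 - l N)\<^sup>-\<^sup>1 y)\<close> is entire by the resolvent identity, so its Taylor series
  converges everywhere, and near \<open>0\<close> it is the Neumann series with coefficients \<open>\<phi> (N\<^sup>n y)\<close>.
  Only an inequality between \<open>norm (sc c x)\<close> and \<open>norm c * norm x\<close> is assumed, so that the lemma
  applies to a complexification with the product norm.
\<close>

lemma resolvent_decay: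
  fixes sc :: "complex \<Rightarrow> 'a::real_normed_vector \<Rightarrow> 'a" and N :: "'a \<Rightarrow> 'a" and \<phi> :: "'a \<Rightarrow> complex"
  assumes vs: "vector_space sc"
    and sc_le: "\<And>c x. norm (sc c x) \<le> B * norm c * norm x"
    and N: "Vector_Spaces.linear sc sc N" "bounded_linear N"
    and \<phi>: "Vector_Spaces.linear sc (*) \<phi>" "bounded_linear \<phi>"
    and sur: "\<And>l y. \<exists>x. x - sc l (N x) = y"
    and bdd: "\<And>l. \<exists>K. \<forall>x. norm x \<le> K * norm (x - sc l (N x))"
    and \<epsilon>: "0 < \<epsilon>"
  shows "\<exists>C. \<forall>n. norm (\<phi> ((N ^^ n) y)) \<le> C * \<epsilon> ^ n"
proof -
  interpret vector_space sc by (rule vs)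
  interpret N: Vector_Spaces.linear sc sc N by (rule N)
  interpret \<phi>: Vector_Spaces.linear sc "(*)" \<phi> by (rule \<phi>)
  interpret Nb: bounded_linear N by (rule N)
  interpret \<phi>b: bounded_linear \<phi> by (rule \<phi>)
  define A where "A l x = x - sc l (N x)" for l x
  define R where "R l y = (SOME x. A l x = y)" for l y
  have AR: "A l (R l y) = y" for l y
    unfolding R_def using sur[of l y] someI_ex[of "\<lambda>x. A l x = y"] by (simp add: A_def)
  have Adiff: "A l (x - y) = A l x - A l y" for l x y
    by (simp add: A_def N.diff scale_right_diff_distrib)
  have Asc: "A l (sc c x) = sc c (A l x)" for l c x
    by (simp add: A_def N.scale scale_right_diff_distrib scale_left_commute)
  have shift: "A m x = A l x - sc (m - l) (N x)" for l m x
    by (simp add: A_def scale_left_diff_distrib)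
  have inj: "x = y" if "A l x = A l y" for l x y
  proof -
    obtain K where "norm (x - y) \<le> K * norm (A l (x - y))" using bdd[of l] unfolding A_def by blast
    then show ?thesis using that by (simp add: Adiff)
  qed
  have resolvent: "R m y - R l y = sc (m - l) (R m (N (R l y)))" for l m y
  proof (rule inj)
    have "A m (R l y) = y - sc (m - l) (N (R l y))" using shift[of m "R l y" l] by (simp add: AR)
    then show "A m (R m y - R l y) = A m (sc (m - l) (R m (N (R l y))))"
      by (simp add: Adiff Asc AR)
  qed
  have cont: "(\<lambda>m. \<phi> (R m v)) \<midarrow>l\<rightarrow> \<phi> (R l v)" for l v
  proof -
    obtain K where K: "\<And>x. norm x \<le> K * norm (A l x)" using bdd[of l] unfolding A_def by blast
    obtain M where M: "0 < M" "\<And>x. norm (N x) \<le> norm x * M" using Nb.pos_bounded by blast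
    define K' where "K' = \<bar>K\<bar> + 1"
    have K': "norm x \<le> K' * norm (A l x)" "0 < K'" for x
      by (auto simp: K'_def intro!: order_trans[OF K mult_right_mono])
    \<comment> \<open>Only positivity is gained: \<open>B\<close> could be zero or negative on a trivial space.\<close>
    define B' where "B' = \<bar>B\<bar> + 1"
    have B': "norm (sc c x) \<le> B' * norm c * norm x" "0 < B'" for c x
      by (auto simp: B'_def mult.assoc intro!: order_trans[OF sc_le[unfolded mult.assoc] mult_right_mono])
    define w where "w = N (R l v)"
    have step: "norm (R m w) \<le> 2 * K' * norm w" if m: "norm (m - l) < 1 / (2 * K' * B' * M)" for m
    proof -
      have "A l (R m w) = w + sc (m - l) (N (R m w))"
        using shift[of m "R m w" l] by (simp add: AR algebra_simps)
      then have "norm (R m w) \<le> K' * norm (w + sc (m - l) (N (R m w)))" using K'(1)[of "R m w"] by simp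
      also have "\<dots> \<le> K' * (norm w + B' * norm (m - l) * (norm (R m w) * M))"
        using K' B' M
        by (intro mult_left_mono order_trans[OF norm_triangle_ineq] add_left_mono order_trans[OF B'(1)]) auto
      also have "\<dots> = K' * norm w + (norm (m - l) * (K' * B' * M)) * norm (R m w)"
        by (simp add: algebra_simps)
      also have "\<dots> \<le> K' * norm w + (1/2) * norm (R m w)"
      proof -
        have "norm (m - l) * (K' * B' * M) \<le> 1/2"
          using m K'(2) B'(2) M(1) by (simp add: field_simps)
        then show ?thesis by (intro add_left_mono mult_right_mono) auto
      qed
      finally show ?thesis by simp
    qed
    have "(\<lambda>m. sc (m - l) (R m w)) \<midarrow>l\<rightarrow> 0"
    proof (rule Lim_null_comparison)
      have "\<forall>\<^sub>F m in at l. norm (m - l) < 1 / (2 * K' * B' * M)"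
        unfolding eventually_at dist_norm using K' B' M by (intro exI[of _ "1 / (2 * K' * B' * M)"]) auto
      then show "\<forall>\<^sub>F m in at l. norm (sc (m - l) (R m w)) \<le> B' * norm (m - l) * (2 * K' * norm w)"
      proof eventually_elim
        case (elim m)
        have "norm (sc (m - l) (R m w)) \<le> B' * norm (m - l) * norm (R m w)" by (rule B')
        also have "\<dots> \<le> B' * norm (m - l) * (2 * K' * norm w)"
          using step[OF elim] B'(2) by (intro mult_left_mono) auto
        finally show ?case .
      qed
      show "(\<lambda>m. B' * norm (m - l) * (2 * K' * norm w)) \<midarrow>l\<rightarrow> 0"
        by (auto intro!: tendsto_eq_intros)
    qed
    then have "(\<lambda>m. R m v - R l v) \<midarrow>l\<rightarrow> 0" by (simp add: resolvent w_def)
    then have "(\<lambda>m. R m v) \<midarrow>l\<rightarrow> R l v" by (simp add: LIM_zero_iff)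
    then show ?thesis by (rule \<phi>b.tendsto)
  qed
  define h where "h l = \<phi> (R l y)" for l
  have "(h has_field_derivative \<phi> (R l (N (R l y)))) (at l)" for l
    unfolding has_field_derivative_iff
  proof (rule Lim_transform_eventually[OF cont])
    have "\<phi> (R m (N (R l y))) = (h m - h l) / (m - l)" if "m \<noteq> l" for m
    proof -
      have "h m - h l = (m - l) * \<phi> (R m (N (R l y)))"
        by (simp add: h_def \<phi>.diff[symmetric] resolvent \<phi>.scale)
      then show ?thesis using that by simp
    qed
    then show "\<forall>\<^sub>F m in at l. \<phi> (R m (N (R l y))) = (h m - h l) / (m - l)"
      by (auto simp: eventually_at intro: exI[of _ 1])
  qed
  then have holo: "h holomorphic_on UNIV"
    by (auto simp: holomorphic_on_def field_differentiable_def has_field_derivative_at_within)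
  define c where "c n = \<phi> ((N ^^ n) y)" for n
  \<comment> \<open>The Neumann series with exact remainder, valid for every \<open>l\<close>.\<close>
  have partial: "h l = (\<Sum>k<n. c k * l ^ k) + l ^ n * \<phi> ((N ^^ n) (R l y))" for l n
  proof (induction n)
    case (Suc n)
    have "(N ^^ n) (R l y - sc l (N (R l y))) = (N ^^ n) y" using AR[of l y] by (simp add: A_def)
    moreover have "(N ^^ n) (a - sc l b) = (N ^^ n) a - sc l ((N ^^ n) b)" for a b
      by (induction n) (simp_all add: N.diff N.scale)
    ultimately have "(N ^^ n) (R l y) = (N ^^ n) y + sc l ((N ^^ n) (N (R l y)))"
      by (metis diff_eq_eq)
    then have "(N ^^ n) (R l y) = (N ^^ n) y + sc l ((N ^^ Suc n) (R l y))"
      by (simp only: funpow_Suc_right o_apply)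
    then have "\<phi> ((N ^^ n) (R l y)) = \<phi> ((N ^^ n) y + sc l ((N ^^ Suc n) (R l y)))"
      by (rule arg_cong)
    then have "\<phi> ((N ^^ n) (R l y)) = c n + l * \<phi> ((N ^^ Suc n) (R l y))"
      by (simp only: \<phi>.add \<phi>.scale c_def)
    then show ?case using Suc by (simp add: algebra_simps)
  qed (simp add: h_def)
  obtain M where M: "0 < M" "\<And>x. norm (N x) \<le> norm x * M" using Nb.pos_bounded by blast
  obtain D where D: "0 < D" "\<And>x. norm (\<phi> x) \<le> norm x * D" using \<phi>b.pos_bounded by blast
  have pow: "norm ((N ^^ n) x) \<le> norm x * M ^ n" for n x
  proof (induction n)
    case (Suc n)
    have "norm ((N ^^ Suc n) x) \<le> norm ((N ^^ n) x) * M" using M(2) by simp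
    also have "\<dots> \<le> norm x * M ^ n * M" using Suc M(1) by (intro mult_right_mono) auto
    finally show ?case by (simp add: algebra_simps)
  qed simp
  have sums: "(\<lambda>n. c n * l ^ n) sums h l" if l: "norm l < 1 / M" for l
    unfolding sums_def
  proof (rule LIM_zero_cancel, rule Lim_null_comparison)
    have "norm ((\<Sum>k<n. c k * l ^ k) - h l) \<le> (norm l * M) ^ n * (norm (R l y) * D)" for n
    proof -
      have "norm ((\<Sum>k<n. c k * l ^ k) - h l) = norm l ^ n * norm (\<phi> ((N ^^ n) (R l y)))"
        using partial[of l n] by (simp add: norm_mult norm_power)
      also have "\<dots> \<le> norm l ^ n * (norm (R l y) * M ^ n * D)"
        using D by (intro mult_left_mono order_trans[OF D(2)] mult_right_mono pow) auto
      finally show ?thesis by (simp add: power_mult_distrib algebra_simps)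
    qed
    then show "\<forall>\<^sub>F n in sequentially. norm ((\<Sum>k<n. c k * l ^ k) - h l) \<le> (norm l * M) ^ n * (norm (R l y) * D)"
      by simp
    have "norm l * M < 1" using l M(1) by (simp add: field_simps)
    then show "(\<lambda>n. (norm l * M) ^ n * (norm (R l y) * D)) \<longlonglongrightarrow> 0"
      using M(1) by (intro tendsto_mult_left_zero LIMSEQ_power_zero) auto
  qed
  have "h has_fps_expansion Abs_fps c"
    unfolding has_fps_expansion_def
  proof
    have "summable (\<lambda>n. c n * complex_of_real (1 / (2 * M)) ^ n)"
      using sums[of "complex_of_real (1 / (2 * M))"] M(1)
      by (intro sums_summable) (auto simp: norm_divide norm_mult field_simps)
    from conv_radius_geI[OF this] have "ereal (1 / (2 * M)) \<le> conv_radius c"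
      using M(1) by (simp add: norm_divide norm_mult)
    moreover have "0 < ereal (1 / (2 * M))" using M(1) by simp
    ultimately have "0 < conv_radius c" by (rule less_le_trans[rotated])
    moreover have "fps_nth (Abs_fps c) = c" by (rule ext) simp
    ultimately show "0 < fps_conv_radius (Abs_fps c)" by (simp add: fps_conv_radius_def)
    have "\<forall>\<^sub>F l in nhds 0. l \<in> ball (0::complex) (1 / M)"
      using M(1) by (intro eventually_nhds_in_open) auto
    then show "\<forall>\<^sub>F l in nhds 0. eval_fps (Abs_fps c) l = h l"
      by eventually_elim (use sums in \<open>auto simp: eval_fps_def intro!: sums_unique[symmetric]\<close>)
  qed
  then have "(\<lambda>n. c n * complex_of_real (1 / \<epsilon>) ^ n) sums h (complex_of_real (1 / \<epsilon>))"
    using has_fps_expansion_imp_sums_complex[of h "Abs_fps c" \<infinity>] holo by simp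
  then have "(\<lambda>n. c n * complex_of_real (1 / \<epsilon>) ^ n) \<longlonglongrightarrow> 0"
    by (intro summable_LIMSEQ_zero sums_summable)
  then have "Bseq (\<lambda>n. c n * complex_of_real (1 / \<epsilon>) ^ n)" by (intro convergent_imp_Bseq convergentI)
  then obtain C where C: "\<And>n. norm (c n * complex_of_real (1 / \<epsilon>) ^ n) \<le> C" by (auto simp: Bseq_def)
  have "norm (c n) \<le> C * \<epsilon> ^ n" for n
    using C[of n] \<epsilon> by (simp add: norm_mult norm_power norm_divide power_divide field_simps)
  then show ?thesis unfolding c_def by blast
qed


text \<open>
  The product of \<open>1 - l N\<close> and \<open>1 - cnj l N\<close>, written with real coefficients.
\<close>

definition quad :: "('a::real_vector \<Rightarrow> 'a) \<Rightarrow> complex \<Rightarrow> 'a \<Rightarrow> 'a" where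
  "quad N l x = x - (2 * Re l) *\<^sub>R N x + (cmod l)\<^sup>2 *\<^sub>R N (N x)"

definition complexify_scale :: "complex \<Rightarrow> 'a::real_vector \<times> 'a \<Rightarrow> 'a \<times> 'a" where
  "complexify_scale c p = (Re c *\<^sub>R fst p - Im c *\<^sub>R snd p, Im c *\<^sub>R fst p + Re c *\<^sub>R snd p)"

lemma vector_space_complexify: "vector_space (complexify_scale :: complex \<Rightarrow> 'a::real_vector \<times> 'a \<Rightarrow> _)"
  by unfold_locales (auto simp: complexify_scale_def algebra_simps)

lemma norm_complexify_scale_le:
  fixes p :: "'a::real_normed_vector \<times> 'a"
  shows "norm (complexify_scale c p) \<le> 4 * norm c * norm p"
proof -
  have part: "norm (a *\<^sub>R x) \<le> norm c * norm p" if "\<bar>a\<bar> \<le> norm c" "norm x \<le> norm p" for a and x :: 'a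
    using that by (simp add: mult_mono)
  have f: "norm (fst p) \<le> norm p" "norm (snd p) \<le> norm p"
    using norm_fst_le[of "fst p" "snd p"] norm_snd_le[of "snd p" "fst p"] by auto
  note c = abs_Re_le_cmod[of c] abs_Im_le_cmod[of c]
  have "norm (complexify_scale c p) \<le> norm (Re c *\<^sub>R fst p - Im c *\<^sub>R snd p) + norm (Im c *\<^sub>R fst p + Re c *\<^sub>R snd p)"
    unfolding complexify_scale_def by (rule norm_Pair_le)
  also have "\<dots> \<le> (norm (Re c *\<^sub>R fst p) + norm (Im c *\<^sub>R snd p)) + (norm (Im c *\<^sub>R fst p) + norm (Re c *\<^sub>R snd p))"
    by (intro add_mono norm_triangle_ineq norm_triangle_ineq4)
  also have "\<dots> \<le> (norm c * norm p + norm c * norm p) + (norm c * norm p + norm c * norm p)"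
    by (intro add_mono part c f)
  finally show ?thesis by simp
qed

text \<open>
  On the complexification \<open>X \<times> X\<close> the operators \<open>1 - l N\<close> and \<open>1 - cnj l N\<close> commute, and their
  product acts as \<open>quad N l\<close> on both components. Hence invertibility of \<open>quad N l\<close> passes to
  \<open>1 - l N\<close>, and \<open>resolvent_decay\<close> applies.
\<close>

lemma quad_resolvent_decay:
  fixes N :: "'a::real_normed_vector \<Rightarrow> 'a" and \<phi> :: "'a \<Rightarrow> real"
  assumes N: "bounded_linear N" and \<phi>: "bounded_linear \<phi>"
    and sur: "\<And>l y. \<exists>x. quad N l x = y"
    and bdd: "\<And>l. \<exists>K. \<forall>x. norm x \<le> K * norm (quad N l x)"
    and \<epsilon>: "0 < \<epsilon>"
  shows "\<exists>C. \<forall>n. \<bar>\<phi> ((N ^^ n) y)\<bar> \<le> C * \<epsilon> ^ n"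
proof -
  interpret N: bounded_linear N by (rule N)
  interpret \<phi>: bounded_linear \<phi> by (rule \<phi>)
  interpret V: vector_space "complexify_scale :: complex \<Rightarrow> 'a \<times> 'a \<Rightarrow> _" by (rule vector_space_complexify)
  define NN where "NN p = (N (fst p), N (snd p))" for p
  define \<Phi> where "\<Phi> p = Complex (\<phi> (fst p)) (\<phi> (snd p))" for p
  have NN: "Vector_Spaces.linear complexify_scale complexify_scale NN"
    by unfold_locales (auto simp: NN_def complexify_scale_def N.add N.diff N.scale N.scaleR)
  have \<Phi>: "Vector_Spaces.linear complexify_scale (*) \<Phi>"
    by unfold_locales (auto simp: \<Phi>_def complexify_scale_def \<phi>.add \<phi>.diff \<phi>.scaleR complex_eq_iff algebra_simps)
  have NNb: "bounded_linear NN" unfolding NN_def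
    by (intro bounded_linear_Pair bounded_linear_compose[OF N] bounded_linear_fst bounded_linear_snd)
  have \<Phi>b: "bounded_linear \<Phi>"
  proof -
    have "\<Phi> = (\<lambda>p. \<phi> (fst p) *\<^sub>R 1 + \<phi> (snd p) *\<^sub>R \<i>)"
      by (auto simp: \<Phi>_def complex_eq_iff)
    moreover have "bounded_linear (\<lambda>p. \<phi> (fst p) *\<^sub>R (1::complex) + \<phi> (snd p) *\<^sub>R \<i>)"
      by (intro bounded_linear_add bounded_linear_scaleR_const bounded_linear_compose[OF \<phi>]
          bounded_linear_fst bounded_linear_snd)
    ultimately show ?thesis by simp
  qed
  define A where "A l p = p - complexify_scale l (NN p)" for l p
  have quad_eq: "quad N l x = x - (Re l *\<^sub>R N x + Re l *\<^sub>R N x)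
      + ((Re l * Re l) *\<^sub>R N (N x) + (Im l * Im l) *\<^sub>R N (N x))" for l x
  proof -
    have "(cmod l)\<^sup>2 = Re l * Re l + Im l * Im l" unfolding cmod_power2 by (simp add: power2_eq_square)
    then show ?thesis by (simp only: quad_def mult_2 scaleR_add_left)
  qed
  have AA: "A (cnj l) (A l p) = (quad N l (fst p), quad N l (snd p))" for l p
    unfolding quad_eq
    by (rule prod_eqI) (simp_all add: A_def NN_def complexify_scale_def N.add N.diff N.scaleR algebra_simps)
  have Ab: "bounded_linear (A l)" for l
  proof -
    have "bounded_linear (\<lambda>p :: 'a \<times> 'a. complexify_scale l p)"
      unfolding complexify_scale_def
      by (intro bounded_linear_Pair bounded_linear_add bounded_linear_sub
          bounded_linear_compose[OF bounded_linear_scaleR_right] bounded_linear_fst bounded_linear_snd)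
    then show ?thesis unfolding A_def
      by (intro bounded_linear_sub bounded_linear_ident bounded_linear_compose[OF _ NNb])
  qed
  have "\<exists>C. \<forall>n. norm (\<Phi> ((NN ^^ n) (y, 0))) \<le> C * \<epsilon> ^ n"
  proof (rule resolvent_decay[OF vector_space_complexify norm_complexify_scale_le NN NNb \<Phi> \<Phi>b _ _ \<epsilon>])
    show "\<exists>p. p - complexify_scale l (NN p) = q" for l q
    proof -
      obtain u v where "quad N (cnj l) u = fst q" "quad N (cnj l) v = snd q"
        using sur by metis
      then have "A l (A (cnj l) (u, v)) = q" using AA[of "cnj l" "(u, v)"] by simp
      then show ?thesis unfolding A_def by blast
    qed
    show "\<exists>K. \<forall>p. norm p \<le> K * norm (p - complexify_scale l (NN p))" for l
    proof -
      obtain K where K: "\<And>x. norm x \<le> K * norm (quad N l x)" using bdd by blast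
      obtain M where M: "0 < M" "\<And>p. norm (A (cnj l) p) \<le> norm p * M"
        using bounded_linear.pos_bounded[OF Ab] by blast
      have "norm p \<le> 2 * \<bar>K\<bar> * M * norm (A l p)" for p
      proof -
        have q: "norm x \<le> \<bar>K\<bar> * norm (quad N l x)" for x
          by (rule order_trans[OF K mult_right_mono]) auto
        have "norm p \<le> norm (fst p) + norm (snd p)"
          using norm_Pair_le[of "fst p" "snd p"] by simp
        also have "\<dots> \<le> \<bar>K\<bar> * norm (quad N l (fst p)) + \<bar>K\<bar> * norm (quad N l (snd p))"
          by (intro add_mono q)
        also have "\<dots> \<le> \<bar>K\<bar> * norm (A (cnj l) (A l p)) + \<bar>K\<bar> * norm (A (cnj l) (A l p))"
          unfolding AA by (intro add_mono mult_left_mono norm_fst_le norm_snd_le) auto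
        also have "\<dots> \<le> 2 * \<bar>K\<bar> * (norm (A l p) * M)"
          using mult_left_mono[OF M(2)[of "A l p"], of "2 * \<bar>K\<bar>"] by simp
        finally show ?thesis by (simp add: algebra_simps)
      qed
      then show ?thesis unfolding A_def by blast
    qed
  qed
  moreover have "(NN ^^ n) (y, 0) = ((N ^^ n) y, 0)" for n
    by (induction n) (auto simp: NN_def N.zero)
  moreover have "norm (\<Phi> (u, 0)) = \<bar>\<phi> u\<bar>" for u
    by (simp add: \<Phi>_def \<phi>.zero cmod_def)
  ultimately show ?thesis by simp
qed

section \<open>Closed range and finite codimension\<close>

text \<open>
  The coefficient of \<open>v\<close> is controlled by the distance of \<open>v\<close> from \<open>C\<close>, so the coefficients of a
  convergent sequence converge.
\<close>

lemma closed_subspace_add_line: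
  fixes C :: "'a::banach set"
  assumes C: "closed C" "subspace C" and v: "v \<notin> C"
  shows "closed {c + t *\<^sub>R v | c t. c \<in> C}"
    and "\<And>c t. c \<in> C \<Longrightarrow> \<bar>t\<bar> * infdist v C \<le> norm (c + t *\<^sub>R v)"
    and "0 < infdist v C"
proof -
  have ne: "C \<noteq> {}" using subspace_0[OF C(2)] by blast
  show d: "0 < infdist v C" using infdist_pos_not_in_closed[OF C(1) ne v] .
  show le: "\<bar>t\<bar> * infdist v C \<le> norm (c + t *\<^sub>R v)" if c: "c \<in> C" for c t
  proof (cases "t = 0")
    case False
    have "(- (1/t)) *\<^sub>R c \<in> C" using c C(2) by (rule subspace_scale[rotated])
    then have "infdist v C \<le> norm (v - (- (1/t)) *\<^sub>R c)" unfolding dist_norm[symmetric] by (rule infdist_le)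
    then have "\<bar>t\<bar> * infdist v C \<le> \<bar>t\<bar> * norm (v - (- (1/t)) *\<^sub>R c)" by (rule mult_left_mono) simp
    also have "\<dots> = norm (t *\<^sub>R (v - (- (1/t)) *\<^sub>R c))" by simp
    also have "t *\<^sub>R (v - (- (1/t)) *\<^sub>R c) = c + t *\<^sub>R v" using False by (simp add: algebra_simps)
    finally show ?thesis .
  qed simp
  show "closed {c + t *\<^sub>R v | c t. c \<in> C}"
    unfolding closed_sequential_limits
  proof (intro allI impI, elim conjE)
    fix y l assume y: "\<forall>n. y n \<in> {c + t *\<^sub>R v | c t. c \<in> C}" and lim: "y \<longlonglongrightarrow> l"
    then obtain c t where ct: "\<And>n. c n \<in> C" "\<And>n. y n = c n + t n *\<^sub>R v" by simp metis
    have "Cauchy t"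
    proof (rule metric_CauchyI)
      fix e :: real assume e: "0 < e"
      obtain M where M: "\<And>m n. m \<ge> M \<Longrightarrow> n \<ge> M \<Longrightarrow> dist (y m) (y n) < e * infdist v C"
        using metric_CauchyD[OF LIMSEQ_imp_Cauchy[OF lim], of "e * infdist v C"] e d by auto
      have "dist (t m) (t n) < e" if "m \<ge> M" "n \<ge> M" for m n
      proof -
        have "\<bar>t m - t n\<bar> * infdist v C \<le> norm ((c m - c n) + (t m - t n) *\<^sub>R v)"
          using ct(1) C(2) by (intro le subspace_diff)
        also have "(c m - c n) + (t m - t n) *\<^sub>R v = y m - y n" by (simp add: ct algebra_simps)
        also have "norm (y m - y n) < e * infdist v C" using M[OF that] by (simp add: dist_norm)
        finally show ?thesis using d by (simp add: dist_real_def)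
      qed
      then show "\<exists>M. \<forall>m\<ge>M. \<forall>n\<ge>M. dist (t m) (t n) < e" by blast
    qed
    then obtain s where s: "t \<longlonglongrightarrow> s" using Cauchy_convergent convergent_def by blast
    have "(\<lambda>n. y n - t n *\<^sub>R v) \<longlonglongrightarrow> l - s *\<^sub>R v" by (intro tendsto_intros lim s)
    then have "c \<longlonglongrightarrow> l - s *\<^sub>R v" by (simp add: ct)
    then have "l - s *\<^sub>R v \<in> C" using C(1) ct(1) closed_sequential_limits by blast
    then show "l \<in> {c + t *\<^sub>R v | c t. c \<in> C}" by (intro CollectI exI[of _ "l - s *\<^sub>R v"] exI[of _ s]) auto
  qed
qed

text \<open>
  The constant \<open>K\<close> says that \<open>A\<close> is an open map from \<open>V\<close> onto its image. It is the quantity that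
  survives perturbations of \<open>A\<close>.
\<close>

definition open_onto_closed_image :: "('a::real_normed_vector \<Rightarrow> 'b::real_normed_vector) \<Rightarrow> 'a set \<Rightarrow> bool" where
  "open_onto_closed_image A V \<longleftrightarrow>
    closed (A ` V) \<and> (\<exists>K\<ge>0. \<forall>v\<in>V. \<exists>v'\<in>V. A v' = A v \<and> norm v' \<le> K * norm (A v))"

definition annihilator :: "('a \<Rightarrow> real) set \<Rightarrow> 'a set" where
  "annihilator F = {x. \<forall>\<phi>\<in>F. \<phi> x = 0}"

lemma subspace_annihilator:
  "(\<And>\<phi>. \<phi> \<in> F \<Longrightarrow> bounded_linear \<phi>) \<Longrightarrow> subspace (annihilator F)"
  by (auto simp: subspace_def annihilator_def linear_simps)

text \<open>
  The conditions in \<open>F\<close> are dropped one at a time, each time enlarging the subspace by at most one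
  dimension. Either the image does not grow, or it grows by a line at positive distance from the
  old closed image, and this distance controls the new coefficient.
\<close>

lemma open_onto_closed_image_finite_codim:
  fixes A :: "'a::real_normed_vector \<Rightarrow> 'b::banach"
  assumes A: "bounded_linear A" and F: "finite F" "\<And>\<phi>. \<phi> \<in> F \<Longrightarrow> bounded_linear \<phi>"
    and good: "open_onto_closed_image A (annihilator F)"
  shows "open_onto_closed_image A UNIV"
  using F good
proof (induction F rule: finite_induct)
  case empty
  then show ?case by (simp add: annihilator_def)
next
  case (insert f F)
  interpret A: bounded_linear A by (rule A)
  interpret f: bounded_linear f using insert.prems by simp
  let ?V = "annihilator F" and ?V' = "annihilator (insert f F)"
  have V: "subspace ?V" and V': "subspace ?V'"
    using insert.prems by (auto intro!: subspace_annihilator)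
  have VV: "?V' = {x \<in> ?V. f x = 0}" by (auto simp: annihilator_def)
  have "open_onto_closed_image A ?V"
  proof (cases "\<exists>w\<in>?V. f w \<noteq> 0")
    case False
    then have "?V' = ?V" unfolding VV by blast
    then show ?thesis using insert.prems by simp
  next
    case True
    then obtain w where w: "w \<in> ?V" "f w \<noteq> 0" by blast
    define m where "m = (1 / f w) *\<^sub>R w"
    have m: "m \<in> ?V" "f m = 1" using w V by (auto simp: m_def f.scaleR subspace_scale)
    have dec: "x - f x *\<^sub>R m \<in> ?V'" if "x \<in> ?V" for x
      using that m V unfolding VV by (auto simp: f.diff f.scaleR subspace_diff subspace_scale)
    have cl: "closed (A ` ?V')" using insert.prems by (simp add: open_onto_closed_image_def)
    obtain K where K: "0 \<le> K" "\<And>v. v \<in> ?V' \<Longrightarrow> \<exists>v'\<in>?V'. A v' = A v \<and> norm v' \<le> K * norm (A v)"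
      using insert.prems unfolding open_onto_closed_image_def by blast
    have sub: "subspace (A ` ?V')" using V' A.linear by (simp add: linear_subspace_image)
    show ?thesis
    proof (cases "A m \<in> A ` ?V'")
      case True
      then obtain m' where m': "m' \<in> ?V'" "A m = A m'" by blast
      have red: "\<exists>u\<in>?V'. A u = A x" if "x \<in> ?V" for x
      proof
        show "(x - f x *\<^sub>R m) + f x *\<^sub>R m' \<in> ?V'"
          using dec[OF that] m' V' by (intro subspace_add subspace_scale)
        show "A ((x - f x *\<^sub>R m) + f x *\<^sub>R m') = A x" by (simp add: A.add A.diff A.scaleR m')
      qed
      have "?V' \<subseteq> ?V" unfolding VV by blast
      moreover have "A ` ?V \<subseteq> A ` ?V'"
      proof
        fix y assume "y \<in> A ` ?V"
        then obtain x where x: "x \<in> ?V" "y = A x" by blast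
        obtain u where "u \<in> ?V'" "A u = A x" using red[OF x(1)] by blast
        then show "y \<in> A ` ?V'" using x(2) by (metis imageI)
      qed
      ultimately have "A ` ?V = A ` ?V'" by blast
      then have "closed (A ` ?V)" using cl by simp
      moreover have "\<exists>v'\<in>?V. A v' = A v \<and> norm v' \<le> K * norm (A v)" if v: "v \<in> ?V" for v
      proof -
        obtain u where u: "u \<in> ?V'" "A u = A v" using red[OF v] by blast
        obtain v' where "v' \<in> ?V'" "A v' = A u" "norm v' \<le> K * norm (A u)" using K(2)[OF u(1)] by blast
        then show ?thesis using u(2) unfolding VV by auto
      qed
      ultimately show ?thesis using K(1) unfolding open_onto_closed_image_def by blast
    next
      case False
      \<comment> \<open>The image grows by the line through \<open>A m\<close>.\<close>
      note line = closed_subspace_add_line[OF cl sub False]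
      define d where "d = infdist (A m) (A ` ?V')"
      have d: "0 < d" unfolding d_def by (rule line(3))
      have "A ` ?V = {c + t *\<^sub>R A m | c t. c \<in> A ` ?V'}"
      proof (intro equalityI subsetI)
        fix y assume "y \<in> A ` ?V"
        then obtain x where x: "x \<in> ?V" "y = A x" by blast
        have "y = A (x - f x *\<^sub>R m) + f x *\<^sub>R A m" using x by (simp add: A.diff A.scaleR)
        then show "y \<in> {c + t *\<^sub>R A m | c t. c \<in> A ` ?V'}" using dec[OF x(1)] by blast
      next
        fix y assume "y \<in> {c + t *\<^sub>R A m | c t. c \<in> A ` ?V'}"
        then obtain u t where u: "u \<in> ?V'" "y = A u + t *\<^sub>R A m" by blast
        then have "y = A (u + t *\<^sub>R m)" by (simp add: A.add A.scaleR)
        moreover have "u + t *\<^sub>R m \<in> ?V" using u m V unfolding VV by (auto simp: subspace_add subspace_scale)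
        ultimately show "y \<in> A ` ?V" by blast
      qed
      then have "closed (A ` ?V)" using line(1) by simp
      moreover
      define K' where "K' = K * (1 + norm (A m) / d) + norm m / d"
      have "\<exists>v'\<in>?V. A v' = A v \<and> norm v' \<le> K' * norm (A v)" if v: "v \<in> ?V" for v
      proof -
        define t where "t = f v"
        obtain u where u: "u \<in> ?V'" "A u = A (v - t *\<^sub>R m)" "norm u \<le> K * norm (A (v - t *\<^sub>R m))"
          using K(2)[OF dec[OF v]] unfolding t_def by blast
        have Av: "A v = A (v - t *\<^sub>R m) + t *\<^sub>R A m" by (simp add: A.diff A.scaleR)
        have "\<bar>t\<bar> * d \<le> norm (A v)"
          unfolding d_def by (subst Av, intro line(2) imageI) (use dec[OF v] in \<open>simp add: t_def\<close>)
        then have t: "\<bar>t\<bar> \<le> norm (A v) / d" using d by (simp add: field_simps)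
        have "norm (A (v - t *\<^sub>R m)) \<le> norm (A v) + \<bar>t\<bar> * norm (A m)"
          using norm_triangle_ineq4[of "A v" "t *\<^sub>R A m"] by (simp add: A.diff A.scaleR)
        also have "\<dots> \<le> norm (A v) + norm (A v) / d * norm (A m)"
          using t by (intro add_left_mono mult_right_mono) auto
        finally have n1: "norm (A (v - t *\<^sub>R m)) \<le> norm (A v) + norm (A v) / d * norm (A m)" .
        have "norm (u + t *\<^sub>R m) \<le> norm u + \<bar>t\<bar> * norm m"
          using norm_triangle_ineq[of u "t *\<^sub>R m"] by simp
        also have "\<dots> \<le> K * (norm (A v) + norm (A v) / d * norm (A m)) + norm (A v) / d * norm m"
          using u(3) n1 t K(1) by (intro add_mono mult_right_mono order_trans[OF u(3) mult_left_mono]) auto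
        also have "\<dots> = K' * norm (A v)" unfolding K'_def by (simp add: algebra_simps)
        finally have "norm (u + t *\<^sub>R m) \<le> K' * norm (A v)" .
        moreover have "A (u + t *\<^sub>R m) = A v" by (simp add: A.add A.diff A.scaleR u(2))
        moreover have "u + t *\<^sub>R m \<in> ?V" using u(1) m V unfolding VV by (auto simp: subspace_add subspace_scale)
        ultimately show ?thesis by blast
      qed
      moreover have "0 \<le> K'" using K(1) d by (simp add: K'_def)
      ultimately show ?thesis unfolding open_onto_closed_image_def by blast
    qed
  qed
  then show ?case using insert.IH insert.prems by simp
qed

lemma open_onto_closed_image_bounded_below:
  fixes A :: "'a::banach \<Rightarrow> 'b::banach"
  assumes A: "bounded_linear A" and V: "closed V" "subspace V"
    and \<epsilon>: "0 < \<epsilon>" "\<And>x. x \<in> V \<Longrightarrow> \<epsilon> * norm x \<le> norm (A x)"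
  shows "open_onto_closed_image A V"
proof -
  have "complete (A ` V)"
    using \<epsilon> V A by (intro complete_isometric_image[of \<epsilon>]) (auto simp: complete_eq_closed)
  moreover have "norm x \<le> (1 / \<epsilon>) * norm (A x)" if "x \<in> V" for x
    using \<epsilon>(2)[OF that] \<epsilon>(1) by (simp add: field_simps)
  ultimately show ?thesis
    using \<epsilon>(1) unfolding open_onto_closed_image_def complete_eq_closed
    by (intro conjI exI[of _ "1 / \<epsilon>"]) auto
qed

lemma closed_annihilator:
  fixes F :: "('a::real_normed_vector \<Rightarrow> real) set"
  assumes "\<And>\<phi>. \<phi> \<in> F \<Longrightarrow> bounded_linear \<phi>"
  shows "closed (annihilator F)"
proof -
  have "annihilator F = (\<Inter>\<phi>\<in>F. \<phi> -` {0})" by (auto simp: annihilator_def)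
  moreover have "closed (\<phi> -` {0})" if "\<phi> \<in> F" for \<phi>
    using assms[OF that] by (intro closed_vimage) (auto intro: linear_continuous_on)
  ultimately show ?thesis by auto
qed

section \<open>Strictly singular perturbations of the identity\<close>

definition nowhere_bounded_below ::
    "('k::real_normed_field \<Rightarrow> 'a::banach \<Rightarrow> 'a) \<Rightarrow> ('a \<Rightarrow> 'a) \<Rightarrow> bool" where
  "nowhere_bounded_below sc Q \<longleftrightarrow>
    (\<forall>M c. Modules.module.subspace sc M \<and> closed M \<and> infinite_dim sc M \<and> 0 < c \<longrightarrow>
      (\<exists>x\<in>M. norm (Q x) < c * norm x))"

text \<open>
  An operator that is bounded below on \<open>M\<close> has a Lipschitz inverse on \<open>S ` M\<close>.
\<close>

lemma strictly_singular_nowhere_bounded_below: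
  assumes sc: "banach_space_over sc" and S: "S \<in> strictly_singular_ops sc"
  shows "nowhere_bounded_below sc S"
  unfolding nowhere_bounded_below_def
proof (intro allI impI, elim conjE, rule ccontr)
  interpret V: banach_space_over sc by (rule sc)
  fix M and c :: real
  assume M: "Modules.module.subspace sc M" "closed M" "infinite_dim sc M" and c: "0 < c"
    and "\<not> (\<exists>x\<in>M. norm (S x) < c * norm x)"
  then have low: "c * norm x \<le> norm (S x)" if "x \<in> M" for x using that by force
  interpret S: bounded_linear S using S by (simp add: strictly_singular_ops_def bounded_ops_def)
  have lip: "dist x y \<le> dist (S x) (S y) / c" if "x \<in> M" "y \<in> M" for x y
    using low[OF V.subspace_diff[OF M(1) that]] c by (simp add: S.diff dist_norm field_simps)
  have inj: "inj_on S M" using lip by (force simp: inj_on_def)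
  have "continuous_on (S ` M) (inv_into M S)"
    by (rule lipschitz_on_continuous_on[of "1 / c"])
      (use c in \<open>auto simp: lipschitz_on_def inv_into_f_f[OF inj] intro: lip\<close>)
  then have "homeomorphism M (S ` M) S (inv_into M S)"
    using inj S.linear S.bounded_linear_axioms by (auto simp: homeomorphism_def linear_continuous_on image_image)
  then show False using S M unfolding strictly_singular_ops_def by blast
qed

text \<open>
  Used for polynomials in \<open>S\<close> without constant term, which factor through \<open>S\<close>.
\<close>

lemma nowhere_bounded_below_dominated:
  assumes S: "nowhere_bounded_below sc S" and Q: "\<And>x. norm (Q x) \<le> K * norm (S x)"
  shows "nowhere_bounded_below sc Q"
  unfolding nowhere_bounded_below_def
proof (intro allI impI, elim conjE)
  fix M and c :: real
  assume M: "Modules.module.subspace sc M" "closed M" "infinite_dim sc M" and c: "0 < c"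
  define K' where "K' = \<bar>K\<bar> + 1"
  have K': "0 < K'" "K \<le> K'" by (auto simp: K'_def)
  obtain x where x: "x \<in> M" "norm (S x) < (c / K') * norm x"
    using S M c K'(1) unfolding nowhere_bounded_below_def by (meson divide_pos_pos)
  have "norm (Q x) \<le> K' * norm (S x)" by (rule order_trans[OF Q mult_right_mono[OF K'(2)]]) simp
  also have "\<dots> < K' * ((c / K') * norm x)" using x(2) K'(1) by (rule mult_strict_left_mono)
  finally show "\<exists>x\<in>M. norm (Q x) < c * norm x" using x(1) K'(1) by auto
qed

lemma banach_space_over_bounded_linear_scale:
  assumes "banach_space_over sc" shows "bounded_linear (sc c)"
proof -
  interpret V: banach_space_over sc by (rule assms)
  show ?thesis
  proof (rule bounded_linear_intro[where K = "norm c"])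
    show "sc c (r *\<^sub>R x) = r *\<^sub>R sc c x" for r x
      by (metis V.scale_of_real V.scale_left_commute)
  qed (auto simp: V.scale_right_distrib V.norm_scale)
qed

lemma closure_subspace_over:
  assumes sc: "banach_space_over sc" and D: "Modules.module.subspace sc D"
  shows "Modules.module.subspace sc (closure D)"
proof -
  interpret V: banach_space_over sc by (rule sc)
  show ?thesis
  proof (rule V.subspaceI)
    show "0 \<in> closure D" using V.subspace_0[OF D] closure_subset by blast
    show "x + y \<in> closure D" if "x \<in> closure D" "y \<in> closure D" for x y
    proof -
      obtain a b where ab: "\<forall>n. a n \<in> D" "a \<longlonglongrightarrow> x" "\<forall>n. b n \<in> D" "b \<longlonglongrightarrow> y"
        using \<open>x \<in> closure D\<close> \<open>y \<in> closure D\<close> unfolding closure_sequential by blast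
      have "(\<lambda>n. a n + b n) \<longlonglongrightarrow> x + y" using ab by (intro tendsto_add)
      moreover have "\<forall>n. a n + b n \<in> D" using ab V.subspace_add[OF D] by blast
      ultimately show ?thesis unfolding closure_sequential by (intro exI[of _ "\<lambda>n. a n + b n"] conjI)
    qed
    show "sc c x \<in> closure D" if "x \<in> closure D" for c x
    proof -
      obtain a where a: "\<forall>n. a n \<in> D" "a \<longlonglongrightarrow> x"
        using \<open>x \<in> closure D\<close> unfolding closure_sequential by blast
      have "(\<lambda>n. sc c (a n)) \<longlonglongrightarrow> sc c x"
        using bounded_linear.tendsto[OF banach_space_over_bounded_linear_scale[OF sc] a(2)] .
      moreover have "\<forall>n. sc c (a n) \<in> D" using a V.subspace_scale[OF D] by blast
      ultimately show ?thesis unfolding closure_sequential by (intro exI[of _ "\<lambda>n. sc c (a n)"] conjI)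
    qed
  qed
qed



text \<open>
  Reduces a condition on all scalar multiples of a vector to finitely many real conditions.
\<close>

lemma scale_coordinates:
  fixes sc :: "'k::{real_normed_field, euclidean_space} \<Rightarrow> 'a::banach \<Rightarrow> 'a"
  assumes sc: "banach_space_over sc"
  shows "sc c x = (\<Sum>b\<in>Basis. (c \<bullet> b) *\<^sub>R sc b x)"
proof -
  interpret V: banach_space_over sc by (rule sc)
  have "sc c x = sc (\<Sum>b\<in>Basis. of_real (c \<bullet> b) * b) x"
    by (simp add: scaleR_conv_of_real[symmetric] euclidean_representation)
  also have "\<dots> = (\<Sum>b\<in>Basis. (c \<bullet> b) *\<^sub>R sc b x)"
    by (simp add: V.scale_sum_left V.scale_scale[symmetric] V.scale_of_real del: V.scale_scale)
  finally show ?thesis .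
qed

text \<open>
  A weak form of biorthogonality: \<open>\<phi> i\<close> vanishes on the span of all later vectors, but may take
  any values on the earlier ones.
\<close>

definition triangular_system ::
    "('k::real_normed_field \<Rightarrow> 'a::banach \<Rightarrow> 'a) \<Rightarrow> (nat \<Rightarrow> 'a) \<Rightarrow> (nat \<Rightarrow> 'a \<Rightarrow> real) \<Rightarrow> bool" where
  "triangular_system sc x \<phi> \<longleftrightarrow>
    (\<forall>n. bounded_linear (\<phi> n) \<and> (\<forall>y. \<bar>\<phi> n y\<bar> \<le> norm y) \<and> norm (x n) = 1 \<and> \<phi> n (x n) = 1) \<and>
    (\<forall>i n c. i < n \<longrightarrow> \<phi> i (sc c (x n)) = 0)"

text \<open>
  Applying \<open>\<phi> n\<close> to a unimodular multiple of the sum isolates \<open>norm (a n)\<close> up to the earlier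
  coefficients, so the bounds at most double in each step.
\<close>

lemma triangular_system_coeff:
  fixes a :: "nat \<Rightarrow> 'k::real_normed_field"
  assumes sc: "banach_space_over sc" and T: "triangular_system sc x \<phi>" and n: "n < N"
  shows "norm (a n) \<le> 2 ^ n * norm (\<Sum>i<N. sc (a i) (x i))"
  using n
proof (induction n rule: less_induct)
  case (less n)
  interpret V: banach_space_over sc by (rule sc)
  let ?y = "\<Sum>i<N. sc (a i) (x i)"
  interpret \<phi>: bounded_linear "\<phi> n" using T by (simp add: triangular_system_def)
  have le: "\<bar>\<phi> n y\<bar> \<le> norm y" and xn: "\<phi> n (x n) = 1" and x1: "norm (x i) = 1"
    and van: "n < i \<Longrightarrow> \<phi> n (sc c (x i)) = 0" for y i c
    using T by (auto simp: triangular_system_def)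
  show ?case
  proof (cases "a n = 0")
    case False
    \<comment> \<open>The unimodular scalar that turns the coefficient \<open>a n\<close> into its modulus.\<close>
    define c where "c = of_real (norm (a n)) / a n"
    have c: "norm c = 1" "c * a n = of_real (norm (a n))" using False by (auto simp: c_def norm_divide)
    have "\<phi> n (sc c ?y) = (\<Sum>i<N. \<phi> n (sc (c * a i) (x i)))"
      by (simp add: V.scale_sum_right \<phi>.sum)
    also have "\<dots> = (\<Sum>i<n. \<phi> n (sc (c * a i) (x i)))
        + (\<phi> n (sc (c * a n) (x n)) + (\<Sum>i\<in>{Suc n..<N}. \<phi> n (sc (c * a i) (x i))))"
    proof -
      have "sum g {..<N} = sum g {..<n} + (g n + sum g {Suc n..<N})" for g :: "nat \<Rightarrow> real"
        using sum.atLeastLessThan_concat[of 0 n N g] sum.atLeast_Suc_lessThan[OF less.prems, of g] less.prems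
        unfolding lessThan_atLeast0 by linarith
      then show ?thesis .
    qed
    also have "(\<Sum>i\<in>{Suc n..<N}. \<phi> n (sc (c * a i) (x i))) = 0" by (intro sum.neutral) (auto simp: van)
    also have "\<phi> n (sc (c * a n) (x n)) = norm (a n)"
      unfolding c V.scale_of_real by (simp add: \<phi>.scaleR xn)
    finally have "norm (a n) = \<phi> n (sc c ?y) - (\<Sum>i<n. \<phi> n (sc (c * a i) (x i)))" by simp
    also have "\<dots> \<le> norm (sc c ?y) + (\<Sum>i<n. norm (sc (c * a i) (x i)))"
    proof -
      have "- (\<Sum>i<n. \<phi> n (sc (c * a i) (x i))) \<le> (\<Sum>i<n. norm (sc (c * a i) (x i)))"
        unfolding sum_negf[symmetric] using le by (intro sum_mono) (meson abs_le_D2)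
      then show ?thesis using le[of "sc c ?y"] by linarith
    qed
    also have "\<dots> = norm ?y + (\<Sum>i<n. norm (a i))" by (simp add: V.norm_scale c x1 norm_mult)
    also have "\<dots> \<le> norm ?y + (\<Sum>i<n. 2 ^ i * norm ?y)"
      using less by (intro add_left_mono sum_mono) auto
    also have "\<dots> = (1 + (\<Sum>i<n. 2 ^ i)) * norm ?y" by (simp add: sum_distrib_right algebra_simps)
    also have "1 + (\<Sum>i<n. 2 ^ i) = (2::real) ^ n" by (induction n) auto
    finally show ?thesis .
  qed auto
qed

lemma triangular_system_span:
  fixes x :: "nat \<Rightarrow> 'a::banach"
  assumes sc: "banach_space_over sc"
  shows "Modules.module.span sc (x ` {..<N}) \<subseteq> range (\<lambda>a. \<Sum>i<N. sc (a i) (x i))"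
proof -
  interpret V: banach_space_over sc by (rule sc)
  show ?thesis
  proof (rule V.span_minimal)
    show "x ` {..<N} \<subseteq> range (\<lambda>a. \<Sum>i<N. sc (a i) (x i))"
    proof
      fix y assume "y \<in> x ` {..<N}"
      then obtain k where k: "k < N" "y = x k" by auto
      have "(\<Sum>i<N. sc (if i = k then 1 else 0) (x i)) = (\<Sum>i<N. if i = k then x i else 0)"
        by (intro sum.cong) auto
      also have "\<dots> = y" using k by simp
      finally show "y \<in> range (\<lambda>a. \<Sum>i<N. sc (a i) (x i))" by (intro image_eqI[where x = "\<lambda>i. if i = k then 1 else 0"]) auto
    qed
    show "V.subspace (range (\<lambda>a. \<Sum>i<N. sc (a i) (x i)))"
    proof (rule V.subspaceI)
      show "0 \<in> range (\<lambda>a. \<Sum>i<N. sc (a i) (x i))" by (rule image_eqI[of _ _ "\<lambda>i. 0"]) auto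
      show "y + z \<in> range (\<lambda>a. \<Sum>i<N. sc (a i) (x i))"
        if y: "y \<in> range (\<lambda>a. \<Sum>i<N. sc (a i) (x i))" and z: "z \<in> range (\<lambda>a. \<Sum>i<N. sc (a i) (x i))" for y z
      proof -
        obtain a b where "y = (\<Sum>i<N. sc (a i) (x i))" "z = (\<Sum>i<N. sc (b i) (x i))" using y z by auto
        then have "y + z = (\<Sum>i<N. sc (a i + b i) (x i))" by (simp add: V.scale_left_distrib sum.distrib)
        then show ?thesis by (intro image_eqI[where x = "\<lambda>i. a i + b i"]) auto
      qed
      show "sc c y \<in> range (\<lambda>a. \<Sum>i<N. sc (a i) (x i))"
        if y: "y \<in> range (\<lambda>a. \<Sum>i<N. sc (a i) (x i))" for c y
      proof -
        obtain a where "y = (\<Sum>i<N. sc (a i) (x i))" using y by auto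
        then have "sc c y = (\<Sum>i<N. sc (c * a i) (x i))" by (simp add: V.scale_sum_right)
        then show ?thesis by (intro image_eqI[where x = "\<lambda>i. c * a i"]) auto
      qed
    qed
  qed
qed

lemma triangular_system_infinite_dim:
  fixes x :: "nat \<Rightarrow> 'a::banach"
  assumes sc: "banach_space_over sc" and T: "triangular_system sc x \<phi>" and M: "range x \<subseteq> M"
  shows "infinite_dim sc M"
proof -
  interpret V: banach_space_over sc by (rule sc)
  have new: "x N \<notin> V.span (x ` {..<N})" for N
  proof
    assume "x N \<in> V.span (x ` {..<N})"
    then obtain a where a: "x N = (\<Sum>i<N. sc (a i) (x i))" using triangular_system_span[OF sc, of x N] by blast
    \<comment> \<open>A vanishing combination in which the coefficient at \<open>N\<close> has modulus one.\<close>
    define b where "b = a(N := - 1)"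
    have "(\<Sum>i<Suc N. sc (b i) (x i)) = (\<Sum>i<N. sc (a i) (x i)) + sc (- 1) (x N)"
      by (simp add: b_def)
    also have "\<dots> = 0" using a by simp
    finally show False using triangular_system_coeff[OF sc T, of N "Suc N" b] by (simp add: b_def)
  qed
  have ind: "V.independent (x ` {..<N}) \<and> card (x ` {..<N}) = N" for N
  proof (induction N)
    case (Suc N)
    have "x N \<notin> x ` {..<N}"
    proof
      assume "x N \<in> x ` {..<N}"
      from V.span_base[OF this] new[of N] show False by (rule notE[rotated])
    qed
    moreover have "V.independent (insert (x N) (x ` {..<N}))"
      using new[of N] conjunct1[OF Suc] by (rule V.independent_insertI)
    ultimately show ?case using conjunct2[OF Suc] unfolding lessThan_Suc image_insert by simp
  qed (simp add: V.independent_empty)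
  show ?thesis unfolding infinite_dim_def
  proof
    assume "\<exists>B. finite B \<and> B \<subseteq> M \<and> M \<subseteq> V.span B"
    then obtain B where B: "finite B" "M \<subseteq> V.span B" by blast
    have "x ` {..<Suc (card B)} \<subseteq> V.span B" using M B by blast
    from V.independent_span_bound[OF B(1) conjunct1[OF ind] this] ind[of "Suc (card B)"]
    show False by simp
  qed
qed

text \<open>
  Unit vectors \<open>x n\<close> are chosen one after the other in the common kernel of the functionals found so
  far, with \<open>norm (A (x n)) < (1/4) ^ Suc n\<close>. In a sum of multiples of the \<open>x n\<close>, the coefficients
  are at most \<open>2 ^ n\<close> times the norm of the sum, so \<open>A\<close> stays small on the closed span.
\<close>

lemma infinite_dim_small_subspace:
  fixes sc :: "'k::{real_normed_field, euclidean_space} \<Rightarrow> 'a::banach \<Rightarrow> 'a"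
  assumes sc: "banach_space_over sc" and A: "bounded_linear A"
    and Asc: "\<And>c x. A (sc c x) = sc c (A x)"
    and small: "\<And>F \<epsilon>. finite F \<Longrightarrow> (\<And>\<phi>. \<phi> \<in> F \<Longrightarrow> bounded_linear \<phi>) \<Longrightarrow> 0 < \<epsilon> \<Longrightarrow>
      \<exists>x\<in>annihilator F. norm (A x) < \<epsilon> * norm x"
  obtains M where "Modules.module.subspace sc M" "closed M" "infinite_dim sc M"
    "\<And>y. y \<in> M \<Longrightarrow> norm (A y) \<le> norm y / 2"
proof -
  interpret V: banach_space_over sc by (rule sc)
  interpret A: bounded_linear A by (rule A)
  define P where "P f n r \<longleftrightarrow> norm (fst r) = 1 \<and> bounded_linear (snd r) \<and> (\<forall>y. \<bar>snd r y\<bar> \<le> norm y) \<and>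
      snd r (fst r) = 1 \<and> norm (A (fst r)) < (1/4) ^ Suc n \<and> (\<forall>i<n. \<forall>c. snd (f i) (sc c (fst r)) = 0)"
    for f :: "nat \<Rightarrow> 'a \<times> ('a \<Rightarrow> real)" and n and r
  have "\<exists>f. \<forall>n. P f n (f n)"
  proof (rule dependent_wellorder_choice)
    show "P f n r = P g n r" if "\<And>i. i < n \<Longrightarrow> f i = g i" for r f g n
      using that by (auto simp: P_def)
    show "\<exists>r. P f n r" if prev: "\<And>i. i < n \<Longrightarrow> P f i (f i)" for n f
    proof -
      \<comment> \<open>Vanishing of \<open>snd (f i)\<close> on the multiples by a real basis of the scalar field gives vanishing on all multiples.\<close>
      define F where "F = (\<lambda>(i, b). \<lambda>y. snd (f i) (sc b y)) ` ({..<n} \<times> (Basis :: 'k set))"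
      have blF: "bounded_linear \<phi>" if "\<phi> \<in> F" for \<phi>
        using that prev unfolding F_def P_def
        by (auto intro!: bounded_linear_compose[OF _ banach_space_over_bounded_linear_scale[OF sc]])
      have "finite F" unfolding F_def by auto
      then obtain x0 where x0: "x0 \<in> annihilator F" "norm (A x0) < (1/4) ^ Suc n * norm x0"
        using small[of F "(1/4) ^ Suc n"] blF by auto
      have nz: "x0 \<noteq> 0" using x0(2) by auto
      define x where "x = (1 / norm x0) *\<^sub>R x0"
      have x1: "norm x = 1" using nz by (simp add: x_def)
      have Ax: "norm (A x) < (1/4) ^ Suc n" using x0(2) nz by (simp add: x_def A.scaleR field_simps)
      have "snd (f i) (sc c x) = 0" if i: "i < n" for i c
      proof -
        interpret \<psi>: bounded_linear "snd (f i)" using prev[OF i] by (simp add: P_def)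
        have "snd (f i) (sc b x0) = 0" if "b \<in> Basis" for b
          using x0(1) i that unfolding annihilator_def F_def by fastforce
        moreover have "sc c x = (1 / norm x0) *\<^sub>R sc c x0"
          unfolding x_def by (rule linear_scale[OF bounded_linear.linear[OF banach_space_over_bounded_linear_scale[OF sc]]])
        ultimately show ?thesis
          by (simp add: scale_coordinates[OF sc, of c x0] \<psi>.scaleR \<psi>.sum)
      qed
      moreover obtain \<phi> where "bounded_linear \<phi>" "\<And>y. \<bar>\<phi> y\<bar> \<le> norm y" "\<phi> x = norm x"
        using norming_functional by blast
      ultimately have "P f n (x, \<phi>)" using x1 Ax by (simp add: P_def)
      then show ?thesis by blast
    qed
  qed
  then obtain f where f: "\<And>n. P f n (f n)" by blast
  define x where "x n = fst (f n)" for n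
  define \<phi> where "\<phi> n = snd (f n)" for n
  have T: "triangular_system sc x \<phi>" and Ax: "norm (A (x n)) \<le> (1/4) ^ Suc n" for n
    using f unfolding triangular_system_def P_def x_def \<phi>_def by (auto intro: less_imp_le)
  have small_sum: "norm (A y) \<le> norm y / 2" if y: "y = (\<Sum>i<N. sc (a i) (x i))" for y a N
  proof -
    have "norm (A y) \<le> (\<Sum>i<N. norm (a i) * norm (A (x i)))"
      unfolding y A.sum Asc by (rule order_trans[OF norm_sum]) (simp add: V.norm_scale)
    also have "\<dots> \<le> (\<Sum>i<N. (2 ^ i * norm y) * (1/4) ^ Suc i)"
      using triangular_system_coeff[OF sc T, of _ N a] unfolding y[symmetric]
      by (intro sum_mono mult_mono Ax) auto
    also have "\<dots> = (\<Sum>i<N. (1/2) ^ i) * (norm y / 4)"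
    proof -
      have "2 ^ i * norm y * (1/4) ^ Suc i = (1/2) ^ i * (norm y / 4)" for i
      proof -
        have "(1/2::real) ^ i = (2 * (1/4)) ^ i" by simp
        then show ?thesis unfolding power_mult_distrib by simp
      qed
      then show ?thesis by (simp only: sum_distrib_right)
    qed
    also have "\<dots> \<le> 2 * (norm y / 4)"
    proof (rule mult_right_mono)
      have "(\<Sum>i<N. (1/2::real) ^ i) \<le> (\<Sum>i. (1/2) ^ i)"
        by (rule sum_le_suminf) (auto intro: summable_geometric)
      then show "(\<Sum>i<N. (1/2::real) ^ i) \<le> 2" by (simp add: suminf_geometric)
    qed simp
    finally show ?thesis by simp
  qed
  define D where "D = V.span (range x)"
  have "norm (A y) \<le> norm y / 2" if y: "y \<in> D" for y
  proof -
    obtain t r where tr: "y = (\<Sum>a\<in>t. sc (r a) a)" "finite t" "t \<subseteq> range x"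
      using y unfolding D_def V.span_explicit by blast
    obtain C where C: "finite C" "t = x ` C" using finite_subset_image[OF tr(2,3)] by blast
    obtain N where N: "C \<subseteq> {..<N}" using C(1) finite_nat_iff_bounded by blast
    have "y \<in> V.span (x ` {..<N})"
      unfolding tr(1) using C(2) N by (intro V.span_sum V.span_scale V.span_base) auto
    then obtain a where "y = (\<Sum>i<N. sc (a i) (x i))" using triangular_system_span[OF sc, of x N] by blast
    then show ?thesis by (rule small_sum)
  qed
  then have "closure D \<subseteq> {y. norm (A y) \<le> norm y / 2}"
    by (intro closure_minimal closed_Collect_le continuous_intros linear_continuous_on A) auto
  moreover have "infinite_dim sc (closure D)"
    using V.span_superset[of "range x"] closure_subset[of D]
    by (intro triangular_system_infinite_dim[OF sc T]) (auto simp: D_def)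
  moreover have "V.subspace (closure D)"
    unfolding D_def by (intro closure_subspace_over[OF sc] V.subspace_span)
  ultimately show thesis using that[of "closure D"] by blast
qed

text \<open>
  Otherwise \<open>1 + Q\<close> is small on an infinite dimensional closed subspace, and there \<open>Q\<close> is close to
  minus the identity, hence bounded below.
\<close>

lemma bounded_below_finite_codim:
  fixes sc :: "'k::{real_normed_field, euclidean_space} \<Rightarrow> 'a::banach \<Rightarrow> 'a"
  assumes sc: "banach_space_over sc" and Q: "bounded_linear Q"
    and Qsc: "\<And>c x. Q (sc c x) = sc c (Q x)" and nbb: "nowhere_bounded_below sc Q"
  shows "\<exists>F \<epsilon>. finite F \<and> (\<forall>\<phi>\<in>F. bounded_linear \<phi>) \<and> 0 < \<epsilon> \<and>
    (\<forall>x\<in>annihilator F. \<epsilon> * norm x \<le> norm (x + Q x))"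
proof (rule ccontr)
  interpret V: banach_space_over sc by (rule sc)
  assume neg: "\<not> ?thesis"
  have "\<exists>x\<in>annihilator F. norm (x + Q x) < \<epsilon> * norm x"
    if "finite F" "\<And>\<phi>. \<phi> \<in> F \<Longrightarrow> bounded_linear \<phi>" "0 < \<epsilon>" for F :: "('a \<Rightarrow> real) set" and \<epsilon>
    using neg that by (meson not_le)
  moreover have "bounded_linear (\<lambda>x. x + Q x)" by (intro bounded_linear_add bounded_linear_ident Q)
  ultimately obtain M where M: "V.subspace M" "closed M" "infinite_dim sc M"
    "\<And>y. y \<in> M \<Longrightarrow> norm (y + Q y) \<le> norm y / 2"
    using infinite_dim_small_subspace[OF sc, of "\<lambda>x. x + Q x"] by (auto simp: Qsc V.scale_right_distrib)
  obtain y where y: "y \<in> M" "norm (Q y) < (1/2) * norm y"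
    using nbb M(1-3) unfolding nowhere_bounded_below_def by (meson half_gt_zero zero_less_one)
  have "norm y \<le> norm (y + Q y) + norm (Q y)" using norm_triangle_ineq4[of "y + Q y" "Q y"] by simp
  then show False using M(4)[OF y(1)] y(2) by simp
qed

text \<open>
  A special case of the Fredholm alternative: the range is closed because \<open>1 + Q\<close> is bounded below
  on a subspace of finite codimension.
\<close>

lemma dense_range_imp_onto:
  fixes sc :: "'k::{real_normed_field, euclidean_space} \<Rightarrow> 'a::banach \<Rightarrow> 'a"
  assumes sc: "banach_space_over sc" and Q: "bounded_linear Q"
    and Qsc: "\<And>c x. Q (sc c x) = sc c (Q x)" and nbb: "nowhere_bounded_below sc Q"
    and dense: "closure (range (\<lambda>x. x + Q x)) = UNIV"
  shows "\<exists>K\<ge>0. \<forall>y. \<exists>x. x + Q x = y \<and> norm x \<le> K * norm y"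
proof -
  have A: "bounded_linear (\<lambda>x. x + Q x)" by (intro bounded_linear_add bounded_linear_ident Q)
  obtain F \<epsilon> where F: "finite F" "\<And>\<phi>. \<phi> \<in> F \<Longrightarrow> bounded_linear \<phi>" "0 < \<epsilon>"
    "\<And>x. x \<in> annihilator F \<Longrightarrow> \<epsilon> * norm x \<le> norm (x + Q x)"
    using bounded_below_finite_codim[OF sc Q Qsc nbb] by blast
  have "open_onto_closed_image (\<lambda>x. x + Q x) (annihilator F)"
    by (rule open_onto_closed_image_bounded_below[OF A closed_annihilator subspace_annihilator])
      (use F in auto)
  then have *: "open_onto_closed_image (\<lambda>x. x + Q x) UNIV"
    using open_onto_closed_image_finite_codim[OF A F(1,2)] by blast
  then have "closed (range (\<lambda>x. x + Q x))" by (simp add: open_onto_closed_image_def)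
  then have sur: "range (\<lambda>x. x + Q x) = UNIV" using dense by simp
  obtain K where K: "0 \<le> K" "\<And>v. \<exists>v'. v' + Q v' = v + Q v \<and> norm v' \<le> K * norm (v + Q v)"
    using * unfolding open_onto_closed_image_def by auto
  have "\<exists>x. x + Q x = y \<and> norm x \<le> K * norm y" for y
  proof -
    obtain v where "y = v + Q v" using sur by (metis UNIV_I rangeE)
    then show ?thesis using K(2)[of v] by simp
  qed
  then show ?thesis using K(1) by blast
qed

section \<open>Injectivity along a path of surjections\<close>

lemma connected_induct_local:
  assumes "connected S" "a \<in> S" "b \<in> S" "P a"
    and "\<And>t. t \<in> S \<Longrightarrow> \<exists>\<delta>>0. \<forall>s\<in>S. dist s t < \<delta> \<longrightarrow> P s = P t"
  shows "P b"
proof -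
  have "\<exists>T. openin (top_of_set S) T \<and> t \<in> T \<and> (\<forall>x\<in>T. \<forall>y\<in>T. P x \<longrightarrow> P y)" if t: "t \<in> S" for t
  proof -
    obtain \<delta> where \<delta>: "0 < \<delta>" "\<And>s. s \<in> S \<Longrightarrow> dist s t < \<delta> \<Longrightarrow> P s = P t" using assms(5)[OF t] by blast
    have "openin (top_of_set S) (S \<inter> ball t \<delta>)" by (rule openin_open_Int) simp
    moreover have "\<forall>x\<in>S \<inter> ball t \<delta>. \<forall>y\<in>S \<inter> ball t \<delta>. P x \<longrightarrow> P y"
    proof (intro ballI impI)
      fix x y assume x: "x \<in> S \<inter> ball t \<delta>" and y: "y \<in> S \<inter> ball t \<delta>" and "P x"
      moreover have "dist x t < \<delta>" "dist y t < \<delta>" using x y by (auto simp: dist_commute)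
      ultimately show "P y" using \<delta>(2)[of x] \<delta>(2)[of y] by blast
    qed
    moreover have "t \<in> S \<inter> ball t \<delta>" using t \<delta>(1) by simp
    ultimately show ?thesis by blast
  qed
  from connected_induction_simple[OF assms(1-3), of P, OF assms(4) this] show ?thesis by blast
qed

text \<open>
  A kernel vector of \<open>B\<close> near \<open>x0\<close> is the sum of the series \<open>x0 + u 1 + u 2 + ...\<close> in which
  \<open>A (u (Suc k)) = (A - B) (u k)\<close>, so that the images under \<open>B\<close> telescope. The terms after \<open>x0\<close>
  have total norm at most half of \<open>norm x0\<close>, so the sum is not zero.
\<close>

lemma kernel_persists:
  fixes A B :: "'a::banach \<Rightarrow> 'a"
  assumes A: "bounded_linear A" and B: "bounded_linear B"
    and G: "\<And>y. \<exists>x. A x = y \<and> norm x \<le> K * norm y"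
    and AB: "\<And>x. norm (A x - B x) \<le> \<eta> * norm x" and \<eta>: "K * \<eta> \<le> 1/3" "0 \<le> K"
    and x0: "A x0 = 0" "x0 \<noteq> 0"
  shows "\<exists>x. B x = 0 \<and> x \<noteq> 0"
proof -
  interpret A: bounded_linear A by (rule A)
  interpret B: bounded_linear B by (rule B)
  obtain g where g: "\<And>y. A (g y) = y" "\<And>y. norm (g y) \<le> K * norm y" using G by metis
  define E where "E x = A x - B x" for x
  define u where "u k = ((\<lambda>x. g (E x)) ^^ k) x0" for k
  have u0: "u 0 = x0" and uS: "u (Suc k) = g (E (u k))" for k by (auto simp: u_def)
  have un: "norm (u k) \<le> (1/3) ^ k * norm x0" for k
  proof (induction k)
    case (Suc k)
    have "norm (u (Suc k)) \<le> K * (\<eta> * norm (u k))"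
      unfolding uS E_def using \<eta> by (intro order_trans[OF g(2) mult_left_mono] AB) auto
    also have "\<dots> = (K * \<eta>) * norm (u k)" by simp
    also have "\<dots> \<le> (1/3) * ((1/3) ^ k * norm x0)"
      using Suc \<eta>(1) by (meson mult_mono norm_ge_zero order_refl zero_le_divide_1_iff zero_le_numeral)
    finally show ?case by simp
  qed (simp add: u0)
  have geo: "summable (\<lambda>k. (1/3::real) ^ k * norm x0)" by (intro summable_mult2 summable_geometric) simp
  have sum_u: "summable u" by (rule summable_comparison_test'[OF geo un])
  have "B (suminf u) = 0"
  proof (rule LIMSEQ_unique)
    have part: "B (\<Sum>k<Suc n. u k) = - E (u n)" for n
    proof (induction n)
      case 0 then show ?case using x0 by (simp add: u0 E_def)
    next
      case (Suc n)
      have "B (u (Suc n)) = E (u n) - E (u (Suc n))"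
        using g(1)[of "E (u n)"] by (simp add: E_def[of "g (E (u n))"] uS)
      then show ?case using Suc by (simp add: B.add)
    qed
    have "(\<lambda>n. \<Sum>k<Suc n. u k) \<longlonglongrightarrow> suminf u" using summable_LIMSEQ[OF sum_u] by (rule LIMSEQ_Suc)
    then have "(\<lambda>n. B (\<Sum>k<Suc n. u k)) \<longlonglongrightarrow> B (suminf u)" by (rule B.tendsto)
    then show "(\<lambda>n. - E (u n)) \<longlonglongrightarrow> B (suminf u)" unfolding part .
    have "u \<longlonglongrightarrow> 0" by (rule summable_LIMSEQ_zero[OF sum_u])
    then have "(\<lambda>n. - E (u n)) \<longlonglongrightarrow> - (A 0 - B 0)" unfolding E_def
      by (intro tendsto_intros A.tendsto B.tendsto)
    then show "(\<lambda>n. - E (u n)) \<longlonglongrightarrow> 0" by (simp add: A.zero B.zero)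
  qed
  moreover have "suminf u \<noteq> 0"
  proof
    assume "suminf u = 0"
    then have "(\<Sum>k. u (Suc k)) = - x0" using suminf_split_head[OF sum_u] u0 by simp
    moreover have s3: "(\<lambda>k. (1/3::real) * ((1/3) ^ k * norm x0)) sums ((1/3) * (1 / (1 - 1/3) * norm x0))"
      by (intro sums_mult sums_mult2 geometric_sums) simp
    moreover have "norm (\<Sum>k. u (Suc k)) \<le> (\<Sum>k. (1/3::real) * ((1/3) ^ k * norm x0))"
      using un[of "Suc _"] by (intro norm_suminf_le sums_summable[OF s3]) simp
    ultimately show False using x0(2) by (simp add: sums_unique[symmetric])
  qed
  ultimately show ?thesis by blast
qed

text \<open>
  Among surjections both injectivity and its failure are stable under small perturbations, the
  former by the lower bound, the latter by \<open>kernel_persists\<close>. The interval is connected.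
\<close>

lemma injective_along_path:
  fixes A :: "real \<Rightarrow> 'a::banach \<Rightarrow> 'a"
  assumes A: "\<And>t. bounded_linear (A t)"
    and L: "0 < L" "\<And>s t x. s \<in> {0..1} \<Longrightarrow> t \<in> {0..1} \<Longrightarrow> norm (A s x - A t x) \<le> L * \<bar>s - t\<bar> * norm x"
    and G: "\<And>t. t \<in> {0..1} \<Longrightarrow> \<exists>K\<ge>0. \<forall>y. \<exists>x. A t x = y \<and> norm x \<le> K * norm y"
    and inj0: "\<And>x. A 0 x = 0 \<Longrightarrow> x = 0"
  shows "\<exists>K. \<forall>x. norm x \<le> K * norm (A 1 x)"
proof -
  have low: "\<exists>K\<ge>0. (\<forall>x. norm x \<le> K * norm (A t x))"
    if t: "t \<in> {0..1}" and inj: "\<forall>x. A t x = 0 \<longrightarrow> x = 0" for t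
  proof -
    interpret bounded_linear "A t" by (rule A)
    obtain K where K: "0 \<le> K" "\<And>y. \<exists>x. A t x = y \<and> norm x \<le> K * norm y" using G[OF t] by blast
    have "norm x \<le> K * norm (A t x)" for x
    proof -
      obtain x' where x': "A t x' = A t x" "norm x' \<le> K * norm (A t x)" using K(2) by blast
      have "A t (x' - x) = 0" using x'(1) by (simp add: diff)
      then have "x' - x = 0" using inj by blast
      then show ?thesis using x'(2) by simp
    qed
    then show ?thesis using K(1) by blast
  qed
  have "\<forall>x. A 1 x = 0 \<longrightarrow> x = 0"
  proof (rule connected_induct_local[of "{0..1::real}" 0 1 "\<lambda>t. \<forall>x. A t x = 0 \<longrightarrow> x = 0"])
    fix t :: real assume t: "t \<in> {0..1}"
    show "\<exists>\<delta>>0. \<forall>s\<in>{0..1}. dist s t < \<delta> \<longrightarrow> (\<forall>x. A s x = 0 \<longrightarrow> x = 0) = (\<forall>x. A t x = 0 \<longrightarrow> x = 0)"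
    proof (cases "\<forall>x. A t x = 0 \<longrightarrow> x = 0")
      case True
      obtain K where K: "0 \<le> K" "\<And>x. norm x \<le> K * norm (A t x)" using low[OF t True] by blast
      have "x = 0" if s: "s \<in> {0..1}" "dist s t < 1 / ((K + 1) * L)" and x: "A s x = 0" for s x
      proof (rule ccontr)
        assume "x \<noteq> 0"
        have "norm x \<le> K * norm (A t x)" by (rule K)
        also have "\<dots> \<le> (K + 1) * (L * \<bar>s - t\<bar> * norm x)"
          using L(2)[OF s(1) t, of x] x K(1) L(1) by (intro mult_mono) auto
        also have "\<dots> = ((K + 1) * L * \<bar>s - t\<bar>) * norm x" by simp
        also have "\<dots> < 1 * norm x"
        proof (rule mult_strict_right_mono)
          have "0 < (K + 1) * L" using K(1) L(1) by simp
          from s(2)[unfolded pos_less_divide_eq[OF this]] show "(K + 1) * L * \<bar>s - t\<bar> < 1"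
            by (simp add: dist_real_def mult.commute)
        qed (simp add: \<open>x \<noteq> 0\<close>)
        finally show False by simp
      qed
      then have "\<forall>s\<in>{0..1}. dist s t < 1 / ((K + 1) * L) \<longrightarrow> (\<forall>x. A s x = 0 \<longrightarrow> x = 0) = (\<forall>x. A t x = 0 \<longrightarrow> x = 0)"
        using True by blast
      moreover have "0 < 1 / ((K + 1) * L)" using K(1) L(1) by simp
      ultimately show ?thesis by blast
    next
      case False
      then obtain x0 where x0: "A t x0 = 0" "x0 \<noteq> 0" by blast
      obtain K where K: "0 \<le> K" "\<And>y. \<exists>x. A t x = y \<and> norm x \<le> K * norm y" using G[OF t] by blast
      have "\<exists>x. A s x = 0 \<and> x \<noteq> 0" if s: "s \<in> {0..1}" "dist s t < 1 / (3 * (K + 1) * L)" for s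
      proof (rule kernel_persists[OF A A K(2) _ _ K(1) x0])
        show "norm (A t x - A s x) \<le> (L * \<bar>t - s\<bar>) * norm x" for x using L(2)[OF t s(1)] .
        have "K * (L * \<bar>t - s\<bar>) \<le> (K + 1) * (L * \<bar>t - s\<bar>)" using L(1) by (intro mult_right_mono) auto
        also have "\<dots> \<le> 1/3"
        proof -
          have "0 < 3 * (K + 1) * L" using K(1) L(1) by simp
          from s(2)[unfolded pos_less_divide_eq[OF this]] show ?thesis
            by (simp add: dist_real_def abs_minus_commute algebra_simps)
        qed
        finally show "K * (L * \<bar>t - s\<bar>) \<le> 1/3" .
      qed
      then have "\<forall>s\<in>{0..1}. dist s t < 1 / (3 * (K + 1) * L) \<longrightarrow> (\<forall>x. A s x = 0 \<longrightarrow> x = 0) = (\<forall>x. A t x = 0 \<longrightarrow> x = 0)"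
        using False by blast
      moreover have "0 < 1 / (3 * (K + 1) * L)" using K(1) L(1) by simp
      ultimately show ?thesis by blast
    qed
  qed (use inj0 in auto)
  then show ?thesis using low[of 1] by auto
qed

text \<open>
  Surjectivity comes from the dense range, injectivity is carried over from \<open>t = 0\<close>. This replaces
  the constancy of the Fredholm index.
\<close>

lemma invertible_along_path:
  fixes sc :: "'k::{real_normed_field, euclidean_space} \<Rightarrow> 'a::banach \<Rightarrow> 'a" and Q :: "real \<Rightarrow> 'a \<Rightarrow> 'a"
  assumes sc: "banach_space_over sc" and Q: "\<And>t. bounded_linear (Q t)"
    and Qsc: "\<And>t c x. Q t (sc c x) = sc c (Q t x)" and nbb: "\<And>t. nowhere_bounded_below sc (Q t)"
    and dense: "\<And>t. closure (range (\<lambda>x. x + Q t x)) = UNIV"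
    and Q0: "\<And>x. Q 0 x = 0"
    and L: "0 < L" "\<And>s t x. s \<in> {0..1} \<Longrightarrow> t \<in> {0..1} \<Longrightarrow> norm (Q s x - Q t x) \<le> L * \<bar>s - t\<bar> * norm x"
  shows "\<exists>x. x + Q 1 x = y" and "\<exists>K. \<forall>x. norm x \<le> K * norm (x + Q 1 x)"
proof -
  note onto = dense_range_imp_onto[OF sc Q Qsc nbb dense]
  show "\<exists>x. x + Q 1 x = y" using onto[of 1] by blast
  show "\<exists>K. \<forall>x. norm x \<le> K * norm (x + Q 1 x)"
  proof (rule injective_along_path[of "\<lambda>t x. x + Q t x", OF _ L(1)])
    show "bounded_linear (\<lambda>x. x + Q t x)" for t by (intro bounded_linear_add bounded_linear_ident Q)
    show "\<exists>K\<ge>0. \<forall>y. \<exists>x. x + Q t x = y \<and> norm x \<le> K * norm y" for t by (rule onto)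
    show "norm (x + Q s x - (x + Q t x)) \<le> L * \<bar>s - t\<bar> * norm x" if "s \<in> {0..1}" "t \<in> {0..1}" for s t x
      using L(2)[OF that, of x] by simp
  qed (simp add: Q0)
qed

section \<open>Dense orbits and dense ranges\<close>

definition hypercyclic_vector :: "('a::topological_space \<Rightarrow> 'a) \<Rightarrow> 'a \<Rightarrow> bool" where
  "hypercyclic_vector T x \<longleftrightarrow> (\<forall>U. open U \<and> U \<noteq> {} \<longrightarrow> (\<exists>n. (T ^^ n) x \<in> U))"

text \<open>
  Along the orbit the gauge is \<open>r ^ n * q x\<close>, which is monotone in \<open>n\<close>, while density of the orbit
  would make its values dense in the half-line if \<open>q\<close> were not zero.
\<close>

lemma eigen_gauge_zero:
  fixes T :: "'a::real_normed_vector \<Rightarrow> 'a" and q :: "'a \<Rightarrow> real"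
  assumes T: "hypercyclic_vector T x" and cont: "continuous_on UNIV q"
    and nonneg: "\<And>y. 0 \<le> q y" and scale: "\<And>t y. 0 \<le> t \<Longrightarrow> q (t *\<^sub>R y) = t * q y"
    and eig: "\<And>y. q (T y) = r * q y" and r: "0 \<le> r"
  shows "q y = 0"
proof (rule ccontr)
  assume "q y \<noteq> 0"
  then have qy: "0 < q y" using nonneg[of y] by simp
  have orbit: "q ((T ^^ n) x) = r ^ n * q x" for n by (induction n) (auto simp: eig)
  have big: "\<exists>n. c < q ((T ^^ n) x)" if "0 \<le> c" for c
  proof -
    have "open {z. c < q z}" using cont by (intro open_Collect_less continuous_intros)
    moreover have "((c + 1) / q y) *\<^sub>R y \<in> {z. c < q z}" using that qy by (simp add: scale)
    ultimately show ?thesis using T unfolding hypercyclic_vector_def by blast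
  qed
  have small: "\<exists>n. q ((T ^^ n) x) < c" if "0 < c" for c
  proof -
    have "open {z. q z < c}" using cont by (intro open_Collect_less continuous_intros)
    moreover have "0 \<in> {z. q z < c}" using that scale[of 0 y] by simp
    ultimately show ?thesis using T unfolding hypercyclic_vector_def by blast
  qed
  show False
  proof (cases "r \<le> 1")
    case True
    obtain n where "q x < q ((T ^^ n) x)" using big[OF nonneg] by blast
    moreover have "r ^ n * q x \<le> 1 * q x" using True r nonneg by (intro mult_right_mono power_le_one) auto
    ultimately show False by (simp add: orbit)
  next
    case False
    show False
    proof (cases "q x = 0")
      case True
      then show False using big[of 0] by (simp add: orbit)
    next
      case False
      then have "0 < q x" using nonneg[of x] by simp
      then obtain n where "q ((T ^^ n) x) < q x" using small by blast
      moreover have "1 * q x \<le> r ^ n * q x" using \<open>\<not> r \<le> 1\<close> nonneg by (intro mult_right_mono one_le_power) auto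
      ultimately show False by (simp add: orbit)
    qed
  qed
qed

lemma infdist_scale_over:
  fixes sc :: "'k::real_normed_field \<Rightarrow> 'a::banach \<Rightarrow> 'a"
  assumes sc: "banach_space_over sc" and M: "Modules.module.subspace sc M"
  shows "infdist (sc c x) M = norm c * infdist x M"
proof -
  interpret V: banach_space_over sc by (rule sc)
  show ?thesis
  proof (cases "c = 0")
    case True
    then show ?thesis using V.subspace_0[OF M] by simp
  next
    case False
    show ?thesis
    proof (rule infdist_image_scale)
      show "M \<noteq> {}" using V.subspace_0[OF M] by blast
      show "sc c ` M \<subseteq> M" using V.subspace_scale[OF M] by blast
      show "M \<subseteq> sc c ` M"
      proof
        fix x assume "x \<in> M"
        then show "x \<in> sc c ` M" using False V.subspace_scale[OF M, of x "1 / c"]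
          by (intro image_eqI[of _ _ "sc (1 / c) x"]) auto
      qed
      show "norm (sc c u - sc c v) = norm c * norm (u - v)" for u v
        by (simp add: V.scale_right_diff_distrib[symmetric] V.norm_scale)
    qed simp
  qed
qed

lemma subspace_over_imp_real:
  assumes sc: "banach_space_over sc" and M: "Modules.module.subspace sc M"
  shows "subspace M"
proof -
  interpret V: banach_space_over sc by (rule sc)
  show ?thesis
  proof (rule subspaceI)
    show "r *\<^sub>R x \<in> M" if "x \<in> M" for r x
      using V.subspace_scale[OF M that, of "of_real r"] by (simp add: V.scale_of_real)
  qed (use V.subspace_0[OF M] V.subspace_add[OF M] in auto)
qed

text \<open>
  The gauge is the distance from the range: modulo the range of \<open>a + S\<close>, the operator \<open>z + S\<close> is
  the scalar \<open>z - a\<close>.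
\<close>

lemma hypercyclic_dense_range:
  fixes sc :: "'k::real_normed_field \<Rightarrow> 'a::banach \<Rightarrow> 'a"
  assumes sc: "banach_space_over sc" and S: "Vector_Spaces.linear sc sc S"
    and hc: "hypercyclic_vector (\<lambda>x. sc z x + S x) x"
  shows "closure (range (\<lambda>x. sc a x + S x)) = UNIV"
proof -
  interpret V: banach_space_over sc by (rule sc)
  interpret S: Vector_Spaces.linear sc sc S by (rule S)
  let ?M = "range (\<lambda>x. sc a x + S x)"
  have M: "V.subspace ?M"
  proof (rule V.subspaceI)
    show "0 \<in> ?M" by (rule image_eqI[of _ _ 0]) (auto simp: S.zero)
    show "u + v \<in> ?M" if uv: "u \<in> ?M" "v \<in> ?M" for u v
    proof -
      obtain u' v' where "u = sc a u' + S u'" "v = sc a v' + S v'" using uv by auto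
      then show ?thesis by (intro image_eqI[of _ _ "u' + v'"]) (auto simp: S.add V.scale_right_distrib)
    qed
    show "sc c u \<in> ?M" if u: "u \<in> ?M" for c u
    proof -
      obtain u' where "u = sc a u' + S u'" using u by auto
      then show ?thesis
        by (intro image_eqI[of _ _ "sc c u'"]) (auto simp: S.scale V.scale_right_distrib mult.commute)
    qed
  qed
  have zero: "infdist y ?M = 0" for y
  proof (rule eigen_gauge_zero[OF hc, where q = "\<lambda>y. infdist y ?M" and r = "norm (z - a)"])
    show "continuous_on UNIV (\<lambda>y. infdist y ?M)" by (intro continuous_intros)
    show "infdist (t *\<^sub>R y) ?M = t * infdist y ?M" if "0 \<le> t" for t y
      using infdist_scale_over[OF sc M, of "of_real t" y] that by (simp add: V.scale_of_real)
    show "infdist (sc z y + S y) ?M = norm (z - a) * infdist y ?M" for y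
    proof -
      have "sc z y + S y = sc (z - a) y + (sc a y + S y)" by (simp add: V.scale_left_diff_distrib)
      then have "infdist (sc z y + S y) ?M = infdist (sc (z - a) y) ?M"
        using infdist_subspace_add[OF subspace_over_imp_real[OF sc M], of "sc a y + S y" "sc (z - a) y"]
        by (simp add: add.assoc)
      then show ?thesis by (simp add: infdist_scale_over[OF sc M])
    qed
  qed (auto simp: infdist_nonneg)
  have "?M \<noteq> {}" by blast
  then show ?thesis using zero in_closure_iff_infdist_zero[of ?M] by blast
qed

text \<open>
  A functional \<open>\<phi>\<close> that vanishes on the range of \<open>quad S l\<close> yields the complex valued functional
  \<open>g = \<phi> - cnj l (\<phi> \<circ> S)\<close> with \<open>g = l (g \<circ> S)\<close>, and \<open>norm \<circ> g\<close> is a gauge to which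
  \<open>eigen_gauge_zero\<close> applies. If \<open>l\<close> is real then \<open>g = 0\<close> only says that \<open>\<phi>\<close> itself is an
  eigenfunctional, and the argument is repeated with \<open>\<phi>\<close>.
\<close>

lemma hypercyclic_dense_range_quad:
  fixes S :: "'a::banach \<Rightarrow> 'a"
  assumes S: "bounded_linear S" and hc: "hypercyclic_vector (\<lambda>x. z *\<^sub>R x + S x) x"
  shows "closure (range (quad S l)) = UNIV"
proof (cases "l = 0")
  case True
  then have "quad S l = (\<lambda>x. x)" by (auto simp: quad_def)
  then show ?thesis by simp
next
  case False
  interpret S: bounded_linear S by (rule S)
  show ?thesis
  proof (rule ccontr)
    assume "closure (range (quad S l)) \<noteq> UNIV"
    then obtain a where a: "a \<notin> closure (range (quad S l))" by blast
    have lin: "linear (quad S l)"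
      by (rule linearI) (auto simp: quad_def S.add S.scaleR algebra_simps)
    from annihilating_functional[OF linear_subspace_image[OF lin subspace_UNIV] a]
    obtain \<phi> :: "'a \<Rightarrow> real" where \<phi>: "bounded_linear \<phi>" "\<And>y. y \<in> range (quad S l) \<Longrightarrow> \<phi> y = 0" "\<phi> a \<noteq> 0"
      by metis
    have \<phi>0: "\<phi> (quad S l y) = 0" for y by (rule \<phi>(2)) simp
    interpret \<phi>: bounded_linear \<phi> by (rule \<phi>)
    define g where "g y = Complex (\<phi> y - Re l * \<phi> (S y)) (Im l * \<phi> (S y))" for y
    have rel: "\<phi> y = 2 * Re l * \<phi> (S y) - (cmod l)\<^sup>2 * \<phi> (S (S y))" for y
      using \<phi>0[of y] by (simp add: quad_def \<phi>.add \<phi>.diff \<phi>.scaleR)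
    have gS: "g y = l * g (S y)" for y
      using rel[of y] unfolding cmod_power2
      by (simp add: g_def complex_eq_iff power2_eq_square algebra_simps)
    have "cmod (g y) = 0" for y
    proof (rule eigen_gauge_zero[OF hc, where q = "\<lambda>y. cmod (g y)" and r = "cmod (of_real z + 1 / l)"])
      show "continuous_on UNIV (\<lambda>y. cmod (g y))"
        unfolding g_def Complex_eq
        by (intro continuous_intros linear_continuous_on \<phi>(1) bounded_linear_compose[OF \<phi>(1) S])
      show "cmod (g (t *\<^sub>R y)) = t * cmod (g y)" if "0 \<le> t" for t y
      proof -
        have "g (t *\<^sub>R y) = of_real t * g y"
          by (simp add: g_def complex_eq_iff \<phi>.scaleR S.scaleR algebra_simps)
        then show ?thesis using that by (simp add: norm_mult)
      qed
      show "cmod (g (z *\<^sub>R y + S y)) = cmod (of_real z + 1 / l) * cmod (g y)" for y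
      proof -
        have "g (z *\<^sub>R y + S y) = of_real z * g y + g (S y)"
          by (simp add: g_def complex_eq_iff \<phi>.add \<phi>.scaleR S.add S.scaleR algebra_simps)
        also have "g (S y) = (1 / l) * g y" using gS[of y] False by simp
        finally show ?thesis by (simp add: norm_mult[symmetric] algebra_simps)
      qed
    qed auto
    then have "g y = 0" for y by simp
    then have g0: "\<phi> y = Re l * \<phi> (S y)" "Im l * \<phi> (S y) = 0" for y
      unfolding g_def complex_eq_iff by (metis complex.sel diff_eq_eq add_0 zero_complex.sel)+
    show False
    proof (cases "Im l = 0")
      case False
      then show False using g0[of a] \<phi>(3) by simp
    next
      case True
      then have Re: "Re l \<noteq> 0" using False by (simp add: complex_eq_iff)
      have "\<bar>\<phi> a\<bar> = 0"
      proof (rule eigen_gauge_zero[OF hc, where q = "\<lambda>y. \<bar>\<phi> y\<bar>" and r = "\<bar>z + 1 / Re l\<bar>"])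
        show "continuous_on UNIV (\<lambda>y. \<bar>\<phi> y\<bar>)" by (intro continuous_intros linear_continuous_on \<phi>(1))
        show "\<bar>\<phi> (z *\<^sub>R y + S y)\<bar> = \<bar>z + 1 / Re l\<bar> * \<bar>\<phi> y\<bar>" for y
        proof -
          have "\<phi> (S y) = (1 / Re l) * \<phi> y" using g0(1)[of y] Re by simp
          then show ?thesis by (simp add: \<phi>.add \<phi>.scaleR abs_mult[symmetric] algebra_simps)
        qed
      qed (auto simp: \<phi>.scaleR abs_mult)
      then show False using \<phi>(3) by simp
    qed
  qed
qed

section \<open>The resolvent of the strictly singular part\<close>

text \<open>
  Quasinilpotency tested on single functionals and vectors, which is what the entire function
  \<open>\<phi> ((1 - l N)\<^sup>-\<^sup>1 y)\<close> gives directly and all that the counting of sign changes uses.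
\<close>

definition weakly_quasinilpotent :: "('a::real_normed_vector \<Rightarrow> 'a) \<Rightarrow> bool" where
  "weakly_quasinilpotent N \<longleftrightarrow>
    (\<forall>\<phi> y. bounded_linear \<phi> \<longrightarrow> rapidly_decaying (\<lambda>n. \<phi> ((N ^^ n) y)))"

lemma bounded_opsD:
  assumes "S \<in> bounded_ops sc"
  shows "bounded_linear S" "Vector_Spaces.linear sc sc S"
  using assms by (auto simp: bounded_ops_def)

text \<open>
  The path is \<open>t \<mapsto> 1 - t l S\<close>.
\<close>

lemma resolvent_onto_bounded_below:
  fixes sc :: "'k::{real_normed_field, euclidean_space} \<Rightarrow> 'a::banach \<Rightarrow> 'a"
  assumes sc: "banach_space_over sc" and S: "S \<in> strictly_singular_ops sc"
    and hc: "hypercyclic_vector (\<lambda>x. sc z x + S x) x0"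
  shows "\<exists>x. x - sc l (S x) = y" and "\<exists>K. \<forall>x. norm x \<le> K * norm (x - sc l (S x))"
proof -
  interpret V: banach_space_over sc by (rule sc)
  have Sb: "S \<in> bounded_ops sc" using S by (simp add: strictly_singular_ops_def)
  interpret S: bounded_linear S by (rule bounded_opsD[OF Sb])
  interpret Sk: Vector_Spaces.linear sc sc S by (rule bounded_opsD[OF Sb])
  note bsc = banach_space_over_bounded_linear_scale[OF sc]
  define Q where "Q t x = - sc (of_real t * l) (S x)" for t x
  have Q: "bounded_linear (Q t)" for t
    unfolding Q_def by (intro bounded_linear_minus bounded_linear_compose[OF bsc] S.bounded_linear_axioms)
  have Qsc: "Q t (sc c x) = sc c (Q t x)" for t c x
    by (simp add: Q_def Sk.scale mult.commute)
  have nbb: "nowhere_bounded_below sc (Q t)" for t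
    by (rule nowhere_bounded_below_dominated[OF strictly_singular_nowhere_bounded_below[OF sc S], of _ "norm (of_real t * l)"])
      (simp add: Q_def V.norm_scale)
  have dense: "closure (range (\<lambda>x. x + Q t x)) = UNIV" for t
  proof (cases "of_real t * l = 0")
    case True
    then show ?thesis unfolding Q_def True by simp
  next
    case False
    define m where "m = of_real t * l"
    have m: "m \<noteq> 0" using False by (simp add: m_def)
    have "sc (- (1 / m)) x + S x \<in> range (\<lambda>x. x + Q t x)" for x
      using m by (intro image_eqI[of _ _ "sc (- (1 / m)) x"])
        (auto simp: Q_def m_def[symmetric] Sk.scale Sk.neg)
    then have "range (\<lambda>x. sc (- (1 / m)) x + S x) \<subseteq> range (\<lambda>x. x + Q t x)" by blast
    then show ?thesis
      using hypercyclic_dense_range[OF sc bounded_opsD(2)[OF Sb] hc, of "- (1 / m)"] closure_mono by blast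
  qed
  obtain M where M: "0 < M" "\<And>x. norm (S x) \<le> norm x * M" using S.pos_bounded by blast
  have lip: "norm (Q s x - Q t x) \<le> (norm l * M + 1) * \<bar>s - t\<bar> * norm x" for s t x
  proof -
    have "Q s x - Q t x = - sc (of_real (s - t) * l) (S x)"
      by (simp add: Q_def algebra_simps V.scale_left_diff_distrib)
    then have "norm (Q s x - Q t x) = \<bar>s - t\<bar> * norm l * norm (S x)"
      by (simp add: V.norm_scale norm_mult del: of_real_diff)
    also have "\<dots> \<le> \<bar>s - t\<bar> * norm l * (norm x * M)" by (intro mult_left_mono M) auto
    also have "\<dots> = (norm l * M) * (\<bar>s - t\<bar> * norm x)" by simp
    also have "\<dots> \<le> (norm l * M + 1) * (\<bar>s - t\<bar> * norm x)" by (intro mult_right_mono) auto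
    finally show ?thesis by (simp add: mult.assoc)
  qed
  have L: "0 < norm l * M + 1" using M(1) by (simp add: add_nonneg_pos)
  have Q1: "x + Q 1 x = x - sc l (S x)" for x by (simp add: Q_def)
  have Q0: "Q 0 x = 0" for x by (simp add: Q_def)
  note * = invertible_along_path[OF sc Q Qsc nbb dense Q0 L lip, unfolded Q1]
  show "\<exists>x. x - sc l (S x) = y" by (rule *(1))
  show "\<exists>K. \<forall>x. norm x \<le> K * norm (x - sc l (S x))" by (rule *(2))
qed

text \<open>
  The path is \<open>t \<mapsto> quad S (t l)\<close>. Over the reals \<open>1 - l S\<close> is available for real \<open>l\<close> only, which
  would not exclude non-real spectrum of \<open>S\<close> in the complexification.
\<close>

lemma quad_onto_bounded_below:
  fixes S :: "'a::banach \<Rightarrow> 'a"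
  assumes sc: "banach_space_over (scaleR :: real \<Rightarrow> 'a \<Rightarrow> 'a)" and S: "S \<in> strictly_singular_ops scaleR"
    and hc: "hypercyclic_vector (\<lambda>x. z *\<^sub>R x + S x) x0"
  shows "\<exists>x. quad S l x = y" and "\<exists>K. \<forall>x. norm x \<le> K * norm (quad S l x)"
proof -
  have Sb: "S \<in> bounded_ops scaleR" using S by (simp add: strictly_singular_ops_def)
  interpret S: bounded_linear S by (rule bounded_opsD[OF Sb])
  obtain M where M: "0 < M" "\<And>x. norm (S x) \<le> norm x * M" using S.pos_bounded by blast
  define Q where "Q t x = (cmod (of_real t * l))\<^sup>2 *\<^sub>R S (S x) - (2 * Re (of_real t * l)) *\<^sub>R S x" for t x
  have quadQ: "x + Q t x = quad S (of_real t * l) x" for t x by (simp add: Q_def quad_def)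
  have Q: "bounded_linear (Q t)" for t
    unfolding Q_def
    by (intro bounded_linear_sub bounded_linear_compose[OF bounded_linear_scaleR_right]
        S.bounded_linear_axioms bounded_linear_compose[OF S.bounded_linear_axioms])
  have Qsc: "Q t (c *\<^sub>R x) = c *\<^sub>R Q t x" for t c x
    by (simp add: Q_def S.scaleR algebra_simps)
  have nbb: "nowhere_bounded_below scaleR (Q t)" for t
  proof (rule nowhere_bounded_below_dominated[OF strictly_singular_nowhere_bounded_below[OF sc S]])
    fix x
    let ?a = "(cmod (of_real t * l))\<^sup>2" and ?b = "\<bar>2 * Re (of_real t * l)\<bar>"
    have "norm (Q t x) \<le> ?a * norm (S (S x)) + ?b * norm (S x)"
      unfolding Q_def by (rule order_trans[OF norm_triangle_ineq4]) simp
    also have "\<dots> \<le> ?a * (norm (S x) * M) + ?b * norm (S x)"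
      by (intro add_right_mono mult_left_mono M) auto
    finally show "norm (Q t x) \<le> (?a * M + ?b) * norm (S x)" by (simp add: algebra_simps)
  qed
  have dense: "closure (range (\<lambda>x. x + Q t x)) = UNIV" for t
    unfolding quadQ by (rule hypercyclic_dense_range_quad[OF S.bounded_linear_axioms hc])
  define L where "L = 2 * (cmod l)\<^sup>2 * M * M + 2 * \<bar>Re l\<bar> * M + 1"
  have L: "0 < L" unfolding L_def using M(1) by (intro add_nonneg_pos add_nonneg_nonneg) auto
  have lip: "norm (Q s x - Q t x) \<le> L * \<bar>s - t\<bar> * norm x" if st: "s \<in> {0..1}" "t \<in> {0..1}" for s t x
  proof -
    have "Q s x - Q t x = ((s\<^sup>2 - t\<^sup>2) * (cmod l)\<^sup>2) *\<^sub>R S (S x) - (2 * (s - t) * Re l) *\<^sub>R S x"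
      by (simp add: Q_def norm_mult power_mult_distrib algebra_simps)
    then have "norm (Q s x - Q t x) \<le> \<bar>s\<^sup>2 - t\<^sup>2\<bar> * (cmod l)\<^sup>2 * norm (S (S x)) + 2 * \<bar>s - t\<bar> * \<bar>Re l\<bar> * norm (S x)"
      using norm_triangle_ineq4[of "((s\<^sup>2 - t\<^sup>2) * (cmod l)\<^sup>2) *\<^sub>R S (S x)" "(2 * (s - t) * Re l) *\<^sub>R S x"]
      by (simp only: norm_scaleR abs_mult abs_numeral abs_power2)
    also have "\<dots> \<le> (2 * \<bar>s - t\<bar>) * (cmod l)\<^sup>2 * (norm x * M * M) + 2 * \<bar>s - t\<bar> * \<bar>Re l\<bar> * (norm x * M)"
    proof (intro add_mono mult_mono)
      have "\<bar>s\<^sup>2 - t\<^sup>2\<bar> = \<bar>s + t\<bar> * \<bar>s - t\<bar>" by (simp add: power2_eq_square abs_mult[symmetric] algebra_simps)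
      also have "\<dots> \<le> 2 * \<bar>s - t\<bar>" using st by (intro mult_right_mono) auto
      finally show "\<bar>s\<^sup>2 - t\<^sup>2\<bar> \<le> 2 * \<bar>s - t\<bar>" .
      show "norm (S (S x)) \<le> norm x * M * M"
        using M by (meson order_trans mult_right_mono less_imp_le)
    qed (use M in auto)
    also have "\<dots> = (2 * (cmod l)\<^sup>2 * M * M + 2 * \<bar>Re l\<bar> * M) * (\<bar>s - t\<bar> * norm x)"
      by (simp add: algebra_simps)
    also have "\<dots> \<le> L * (\<bar>s - t\<bar> * norm x)" unfolding L_def by (intro mult_right_mono) auto
    finally show ?thesis by (simp add: mult.assoc)
  qed
  have Q0: "Q 0 x = 0" for x by (simp add: Q_def)
  have Q1: "x + Q 1 x = quad S l x" for x using quadQ[of x 1] by simp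
  note * = invertible_along_path[OF sc Q Qsc nbb dense Q0 L lip, unfolded Q1]
  show "\<exists>x. quad S l x = y" by (rule *(1))
  show "\<exists>K. \<forall>x. norm x \<le> K * norm (quad S l x)" by (rule *(2))
qed

lemma weakly_quasinilpotent_real:
  fixes S :: "'a::banach \<Rightarrow> 'a"
  assumes S: "S \<in> strictly_singular_ops scaleR"
    and hc: "hypercyclic_vector (\<lambda>x. z *\<^sub>R x + S x) x0"
  shows "weakly_quasinilpotent (\<lambda>x. c *\<^sub>R S x)"
  unfolding weakly_quasinilpotent_def rapidly_decaying_def
proof (intro allI impI)
  fix \<phi> :: "'a \<Rightarrow> real" and y and \<epsilon> :: real
  assume \<phi>: "bounded_linear \<phi>" and \<epsilon>: "0 < \<epsilon>"
  have Sb: "bounded_linear S" using S by (simp add: strictly_singular_ops_def bounded_ops_def)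
  interpret S: bounded_linear S by (rule Sb)
  have quadc: "quad (\<lambda>x. c *\<^sub>R S x) l = quad S (of_real c * l)" for l
    by (auto simp: quad_def S.scaleR norm_mult power_mult_distrib power2_eq_square algebra_simps)
  show "\<exists>C. \<forall>k. \<bar>\<phi> (((\<lambda>x. c *\<^sub>R S x) ^^ k) y)\<bar> \<le> C * \<epsilon> ^ k"
  proof (rule quad_resolvent_decay[OF _ \<phi> _ _ \<epsilon>])
    show "bounded_linear (\<lambda>x. c *\<^sub>R S x)" by (intro bounded_linear_compose[OF bounded_linear_scaleR_right] Sb)
  qed (unfold quadc, (rule quad_onto_bounded_below[OF banach_space_over_real S hc])+)
qed

text \<open>
  A real functional \<open>\<phi>\<close> is the real part of the complex functional \<open>\<Phi> y = \<phi> y - \<i> \<phi> (\<i> y)\<close>, to which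
  \<open>resolvent_decay\<close> applies.
\<close>

lemma weakly_quasinilpotent_complex:
  fixes sc :: "complex \<Rightarrow> 'a::banach \<Rightarrow> 'a"
  assumes sc: "banach_space_over sc" and S: "S \<in> strictly_singular_ops sc"
    and hc: "hypercyclic_vector (\<lambda>x. sc z x + S x) x0"
  shows "weakly_quasinilpotent (\<lambda>x. sc c (S x))"
  unfolding weakly_quasinilpotent_def rapidly_decaying_def
proof (intro allI impI)
  fix \<phi> :: "'a \<Rightarrow> real" and y and \<epsilon> :: real
  assume \<phi>: "bounded_linear \<phi>" and \<epsilon>: "0 < \<epsilon>"
  interpret V: banach_space_over sc by (rule sc)
  interpret \<phi>: bounded_linear \<phi> by (rule \<phi>)
  have Sb: "S \<in> bounded_ops sc" using S by (simp add: strictly_singular_ops_def)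
  interpret Sk: Vector_Spaces.linear sc sc S by (rule bounded_opsD[OF Sb])
  note bsc = banach_space_over_bounded_linear_scale[OF sc]
  define \<Phi> where "\<Phi> y = Complex (\<phi> y) (- \<phi> (sc \<i> y))" for y
  have cartesian: "sc a y = Re a *\<^sub>R y + Im a *\<^sub>R sc \<i> y" for a y
  proof -
    have "sc a y = sc (of_real (Re a) + of_real (Im a) * \<i>) y"
      by (simp add: complex_eq[of a, symmetric] mult.commute)
    then show ?thesis
      by (simp add: V.scale_left_distrib V.scale_scale[symmetric] V.scale_of_real del: V.scale_scale)
  qed
  have ii: "sc \<i> (sc \<i> y) = - y" for y by simp
  have \<Phi>: "Vector_Spaces.linear sc (*) \<Phi>"
  proof (unfold_locales)
    show "\<Phi> (u + v) = \<Phi> u + \<Phi> v" for u v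
      by (simp add: \<Phi>_def complex_eq_iff \<phi>.add V.scale_right_distrib)
    show "\<Phi> (sc a u) = a * \<Phi> u" for a u
    proof -
      have "sc \<i> (sc a u) = Re a *\<^sub>R sc \<i> u - Im a *\<^sub>R u"
        using cartesian[of a "sc \<i> u"] by (simp add: V.scale_left_commute ii del: V.scale_scale)
      then show ?thesis unfolding \<Phi>_def
        by (simp add: complex_eq_iff cartesian[of a u] \<phi>.add \<phi>.diff \<phi>.scaleR)
    qed
  qed
  have \<Phi>b: "bounded_linear \<Phi>"
  proof -
    have "\<Phi> = (\<lambda>p. \<phi> p *\<^sub>R 1 + (- \<phi> (sc \<i> p)) *\<^sub>R \<i>)"
      by (auto simp: \<Phi>_def complex_eq_iff)
    moreover have "bounded_linear (\<lambda>p. \<phi> p *\<^sub>R (1::complex) + (- \<phi> (sc \<i> p)) *\<^sub>R \<i>)"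
      by (intro bounded_linear_add bounded_linear_scaleR_const bounded_linear_minus
          bounded_linear_compose[OF \<phi>] bsc \<phi>)
    ultimately show ?thesis by simp
  qed
  define N where "N x = sc c (S x)" for x
  have N: "Vector_Spaces.linear sc sc N" unfolding N_def
    by unfold_locales (auto simp: Sk.add Sk.scale V.scale_right_distrib mult.commute)
  have Nb: "bounded_linear N" unfolding N_def
    by (intro bounded_linear_compose[OF bsc] bounded_opsD[OF Sb])
  have Nl: "x - sc l (N x) = x - sc (l * c) (S x)" for l x by (simp add: N_def)
  have "\<exists>C. \<forall>n. norm (\<Phi> ((N ^^ n) y)) \<le> C * \<epsilon> ^ n"
  proof (rule resolvent_decay[OF V.vector_space_axioms _ N Nb \<Phi> \<Phi>b _ _ \<epsilon>])
    show "norm (sc a x) \<le> 1 * norm a * norm x" for a x by (simp add: V.norm_scale)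
  qed (unfold Nl, (rule resolvent_onto_bounded_below[OF sc S hc])+)
  then obtain C where C: "\<And>n. norm (\<Phi> ((N ^^ n) y)) \<le> C * \<epsilon> ^ n" by blast
  have "\<bar>\<phi> u\<bar> \<le> norm (\<Phi> u)" for u using abs_Re_le_cmod[of "\<Phi> u"] by (simp add: \<Phi>_def)
  then show "\<exists>C. \<forall>k. \<bar>\<phi> (((\<lambda>x. sc c (S x)) ^^ k) y)\<bar> \<le> C * \<epsilon> ^ k"
    using C unfolding N_def by (meson order_trans)
qed

section \<open>Return times\<close>

text \<open>
  Along an eigenfunctional the values \<open>\<phi> (N\<^sup>n y)\<close> form a geometric sequence, which excludes
  eigenvalues other than \<open>0\<close>; the eigenvalue \<open>0\<close> is excluded by the dense range.
\<close>

lemma weakly_quasinilpotent_no_eigenfunctional: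
  fixes N :: "'a::banach \<Rightarrow> 'a" and \<phi> :: "'a \<Rightarrow> real"
  assumes N: "bounded_linear N" "weakly_quasinilpotent N" and dense: "closure (range N) = UNIV"
    and \<phi>: "bounded_linear \<phi>" and eig: "\<And>y. \<phi> (N y) = c * \<phi> y"
  shows "\<phi> y = 0"
proof (cases "c = 0")
  case True
  then have "range N \<subseteq> {y. \<phi> y = 0}" using eig by auto
  moreover have "closed {y. \<phi> y = 0}"
    by (intro closed_Collect_eq continuous_intros linear_continuous_on \<phi>)
  ultimately have "closure (range N) \<subseteq> {y. \<phi> y = 0}" by (rule closure_minimal)
  then show ?thesis using dense by blast
next
  case False
  have pow: "\<phi> ((N ^^ n) y) = c ^ n * \<phi> y" for n by (induction n) (auto simp: eig)
  have "rapidly_decaying (\<lambda>n. \<phi> ((N ^^ n) y))" using N(2) \<phi> by (simp add: weakly_quasinilpotent_def)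
  then obtain C where C: "\<And>n. \<bar>\<phi> ((N ^^ n) y)\<bar> \<le> C * (\<bar>c\<bar> / 2) ^ n"
    unfolding rapidly_decaying_def using False by (metis half_gt_zero zero_less_abs_iff)
  have "\<bar>\<phi> y\<bar> \<le> C * (1/2) ^ n" for n
  proof -
    have "\<bar>c\<bar> ^ n * \<bar>\<phi> y\<bar> \<le> \<bar>c\<bar> ^ n * (C * (1/2) ^ n)"
      using C[of n] by (simp add: pow abs_mult power_abs power_divide mult.commute)
    then show ?thesis using False by (subst (asm) mult_le_cancel_left_pos) auto
  qed
  moreover have "(\<lambda>n. C * (1/2) ^ n) \<longlonglongrightarrow> C * 0" by (intro tendsto_intros) auto
  ultimately have "\<bar>\<phi> y\<bar> \<le> C * 0" by (intro LIMSEQ_le_const) auto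
  then show ?thesis by simp
qed

lemma independent_functionals_values:
  fixes f g :: "'a::real_vector \<Rightarrow> real"
  assumes f: "linear f" and g: "linear g" and a: "f a \<noteq> 0"
    and indep: "\<And>c. \<exists>y. g y \<noteq> c * f y"
  obtains u where "f u = s" "g u = t"
proof -
  define e where "e = (1 / f a) *\<^sub>R a"
  have fe: "f e = 1" using a by (simp add: e_def linear_scale[OF f])
  obtain y where y: "g y \<noteq> g e * f y" using indep by blast
  define v where "v = y - f y *\<^sub>R e"
  have fv: "f v = 0" by (simp add: v_def linear_diff[OF f] linear_scale[OF f] fe)
  have gv: "g v \<noteq> 0" using y by (simp add: v_def linear_diff[OF g] linear_scale[OF g] mult.commute)
  define u where "u = s *\<^sub>R e + ((t - s * g e) / g v) *\<^sub>R v"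
  have "f u = s" by (simp add: u_def linear_add[OF f] linear_scale[OF f] fe fv)
  moreover have "g u = t" using gv by (simp add: u_def linear_add[OF g] linear_scale[OF g])
  ultimately show thesis by (rule that)
qed

text \<open>
  The binomial theorem for \<open>I + N\<close>.
\<close>

lemma newton_functional:
  fixes N :: "'a::real_vector \<Rightarrow> 'a" and \<psi> :: "'a \<Rightarrow> real"
  assumes N: "linear N" and \<psi>: "linear \<psi>"
  shows "\<psi> (((\<lambda>x. x + N x) ^^ n) x) = newton (\<lambda>k. \<psi> ((N ^^ k) x)) n"
  using \<psi>
proof (induction n arbitrary: \<psi>)
  case (Suc n)
  have "linear (\<lambda>y. \<psi> (N y))" using linear_compose[OF N Suc.prems] by (simp add: o_def)
  from Suc.IH[OF this] Suc.IH[OF Suc.prems] show ?case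
    by (simp add: newton_Suc linear_add[OF Suc.prems])
qed simp


text \<open>
  If \<open>T\<^sup>n x\<close> is near \<open>u\<close>, then \<open>(I + N)\<^sup>n x\<close> is near a scalar multiple of \<open>u\<close>, and multiplying by a
  suitable unimodular scalar \<open>e\<close> from a finite net brings it near a positive multiple of \<open>u\<close>, where
  \<open>\<phi>\<close> is positive and \<open>\<phi> \<circ> (I + N)\<close> is negative. So \<open>n\<close> is a sign drop of one of finitely many
  sequences.
\<close>

lemma return_set_null_density:
  fixes sc :: "'k::{real_normed_field, euclidean_space} \<Rightarrow> 'a::banach \<Rightarrow> 'a" and \<phi> :: "'a \<Rightarrow> real"
  assumes sc: "banach_space_over sc" and z: "z \<noteq> 0"
    and N: "bounded_linear N" "\<And>c x. N (sc c x) = sc c (N x)" "weakly_quasinilpotent N"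
    and T: "\<And>x. T x = sc z (x + N x)"
    and \<phi>: "bounded_linear \<phi>" and u: "\<phi> u = 1" "\<phi> (N u) = -2"
  obtains r where "0 < r" "\<And>x. null_density {n. (T ^^ n) x \<in> ball u r}"
proof -
  interpret V: banach_space_over sc by (rule sc)
  interpret \<phi>: bounded_linear \<phi> by (rule \<phi>)
  interpret N: bounded_linear N by (rule N)
  note bsc = banach_space_over_bounded_linear_scale[OF sc]
  define P where "P x = x + N x" for x
  have Pb: "bounded_linear P" unfolding P_def by (intro bounded_linear_add bounded_linear_ident N(1))
  have Psc: "P (sc c x) = sc c (P x)" for c x by (simp add: P_def N(2) V.scale_right_distrib)
  \<comment> \<open>A neighbourhood of \<open>u\<close>, since \<open>\<phi> u = 1\<close> and \<open>\<phi> (P u) = -1\<close>.\<close>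
  define W where "W = {w. 1/2 < \<phi> w \<and> \<phi> (P w) < - (1/2)}"
  have "W = {w. 1/2 < \<phi> w} \<inter> {w. \<phi> (P w) < - (1/2)}" by (auto simp: W_def)
  moreover have "open {w. 1/2 < \<phi> w}" "open {w. \<phi> (P w) < - (1/2)}"
    by (intro open_Collect_less continuous_intros linear_continuous_on \<phi> bounded_linear_compose[OF \<phi> Pb])+
  ultimately have "open W" by (simp add: open_Int)
  moreover have "u \<in> W" using u by (simp add: W_def P_def \<phi>.add)
  ultimately obtain d where d: "0 < d" "ball u d \<subseteq> W" by (auto simp: open_contains_ball)
  \<comment> \<open>For \<open>norm (a - 1) < r\<close> and \<open>norm (v - u) < r\<close> the distance of \<open>a v\<close> from \<open>u\<close> is less than \<open>r (1 + norm u) + r\<close>.\<close>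
  define r where "r = min 1 (d / (norm u + 2))"
  have nu: "0 < norm u + 2" by (simp add: add_nonneg_pos)
  have r: "0 < r" "r \<le> 1" "r * (norm u + 2) \<le> d"
  proof -
    show "0 < r" "r \<le> 1" using d(1) nu by (auto simp: r_def)
    have "r \<le> d / (norm u + 2)" by (simp add: r_def)
    then show "r * (norm u + 2) \<le> d" using nu by (simp add: pos_le_divide_eq)
  qed
  have inW: "sc a v \<in> W" if a: "norm (a - 1) < r" and v: "v \<in> ball u r" for a v
  proof -
    have vu: "norm (v - u) < r" using v by (simp add: dist_norm norm_minus_commute)
    have "norm v \<le> norm (v - u) + norm u" using norm_triangle_ineq[of "v - u" u] by simp
    then have nv: "norm v \<le> 1 + norm u" using vu r(2) by simp
    have "sc a v - u = sc (a - 1) v + (v - u)" by (simp add: V.scale_left_diff_distrib)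
    then have "norm (sc a v - u) \<le> norm (a - 1) * norm v + norm (v - u)"
      using norm_triangle_ineq[of "sc (a - 1) v" "v - u"] by (simp add: V.norm_scale add_diff_eq)
    also have "\<dots> < r * (1 + norm u) + r"
      using a nv vu r(1) by (intro add_le_less_mono mult_mono) auto
    also have "\<dots> \<le> d" using r(3) by (simp add: algebra_simps)
    finally show ?thesis using d(2) by (auto simp: dist_norm norm_minus_commute)
  qed
  obtain E :: "'k set" where E: "finite E" "sphere 0 1 \<subseteq> (\<Union>e\<in>E. ball e r)"
  proof -
    have "sphere (0::'k) 1 \<subseteq> (\<Union>e\<in>sphere 0 1. ball e r)" using r(1) by force
    then show thesis
      using compactE_image[OF compact_sphere, of "sphere 0 1" "\<lambda>e. ball e r" "0::'k" 1] that
      by (metis open_ball)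
  qed
  have "null_density {n. (T ^^ n) x \<in> ball u r}" for x
  proof -
    define f where "f e n = \<phi> (sc e ((P ^^ n) x))" for e n
    have f_newton: "f e = newton (\<lambda>k. \<phi> (sc e ((N ^^ k) x)))" for e
    proof
      show "f e n = newton (\<lambda>k. \<phi> (sc e ((N ^^ k) x))) n" for n
        unfolding f_def P_def
        by (rule newton_functional[OF N.linear bounded_linear.linear[OF bounded_linear_compose[OF \<phi> bsc]]])
    qed
    have decay: "rapidly_decaying (\<lambda>k. \<phi> (sc e ((N ^^ k) x)))" for e
      using N(3) bounded_linear_compose[OF \<phi> bsc] unfolding weakly_quasinilpotent_def by blast
    have TP: "(T ^^ n) x = sc (z ^ n) ((P ^^ n) x)" for n
      by (induction n) (simp_all add: T P_def[symmetric] Psc)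
    have "{n. (T ^^ n) x \<in> ball u r} \<subseteq> (\<Union>e\<in>E. sign_drops (1/2) (1 / norm z) (f e))"
    proof
      fix n assume "n \<in> {n. (T ^^ n) x \<in> ball u r}"
      then have v: "(T ^^ n) x \<in> ball u r" by simp
      \<comment> \<open>The unimodular part of \<open>z\<^sup>-\<^sup>n\<close>.\<close>
      define c where "c = of_real (norm z ^ n) / z ^ n"
      have c1: "norm c = 1" using z by (simp add: c_def norm_divide norm_power)
      then have "inverse c \<in> sphere 0 1" by (simp add: norm_inverse)
      then obtain e where e: "e \<in> E" "dist e (inverse c) < r" using E(2) by auto
      have "norm (e * c - 1) = norm ((e - inverse c) * c)"
      proof -
        have "c \<noteq> 0" using c1 by auto
        then have "inverse c * c = 1" by simp
        then show ?thesis by (simp only: left_diff_distrib)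
      qed
      also have "\<dots> < r" using e(2) c1 by (simp add: norm_mult dist_norm)
      finally have W: "sc (e * c) ((T ^^ n) x) \<in> W" by (rule inW[OF _ v])
      have "sc (e * c) ((T ^^ n) x) = sc (of_real (norm z ^ n)) (sc e ((P ^^ n) x))"
        using z by (simp add: TP c_def mult.commute)
      then have eq: "sc (e * c) ((T ^^ n) x) = (norm z ^ n) *\<^sub>R sc e ((P ^^ n) x)"
        unfolding V.scale_of_real .
      have "1/2 < norm z ^ n * f e n"
        using W by (simp add: W_def eq f_def \<phi>.scaleR)
      moreover have "norm z ^ n * f e (Suc n) < - (1/2)"
        using W by (simp add: W_def eq f_def \<phi>.scaleR linear_scale[OF bounded_linear.linear[OF Pb]] Psc)
      ultimately have "n \<in> sign_drops (1/2) (1 / norm z) (f e)"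
        using z by (simp add: sign_drops_def power_divide field_simps)
      then show "n \<in> (\<Union>e\<in>E. sign_drops (1/2) (1 / norm z) (f e))" using e(1) by blast
    qed
    moreover have "null_density (\<Union>e\<in>E. sign_drops (1/2) (1 / norm z) (f e))"
      using E(1) z decay by (intro null_density_UN) (auto simp: f_newton intro!: null_density_sign_drops)
    ultimately show ?thesis by (rule null_density_subset[rotated])
  qed
  then show thesis using r(1) that by blast
qed

lemma u_frequently_hypercyclic_imp_hypercyclic:
  fixes T :: "'a::topological_space \<Rightarrow> 'a"
  assumes "\<forall>U. open U \<and> U \<noteq> {} \<longrightarrow> upper_density {n. 0 < n \<and> (T ^^ n) x \<in> U} > 0"
  shows "hypercyclic_vector T x"
  unfolding hypercyclic_vector_def
proof (intro allI impI)
  fix U :: "'a set" assume "open U \<and> U \<noteq> {}"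
  then have pos: "upper_density {n. 0 < n \<and> (T ^^ n) x \<in> U} > 0" using assms by blast
  show "\<exists>n. (T ^^ n) x \<in> U"
  proof (rule ccontr)
    assume "\<not> ?thesis"
    then have none: "{n. 0 < n \<and> (T ^^ n) x \<in> U} = {}" by blast
    have "upper_density {} = 0" by (rule upper_density_null) (simp add: null_density_def)
    then show False using pos unfolding none by simp
  qed
qed

text \<open>
  Quasinilpotency enters as a hypothesis because its proofs for real and for complex scalars differ.
\<close>

lemma not_u_frequently_hypercyclic:
  fixes sc :: "'k::{real_normed_field, euclidean_space} \<Rightarrow> 'a::banach \<Rightarrow> 'a"
  assumes sc: "banach_space_over sc" and inf: "infinite_dim sc (UNIV :: 'a set)" and S: "S \<in> bounded_ops sc"
    and T: "T = (\<lambda>x. sc z x + S x)"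
    and qn: "\<And>x0 c. hypercyclic_vector T x0 \<Longrightarrow> weakly_quasinilpotent (\<lambda>x. sc c (S x))"
  shows "\<not> u_frequently_hypercyclic T"
proof
  assume "u_frequently_hypercyclic T"
  then obtain x where x: "\<forall>U. open U \<and> U \<noteq> {} \<longrightarrow> upper_density {n. 0 < n \<and> (T ^^ n) x \<in> U} > 0"
    unfolding u_frequently_hypercyclic_def by blast
  interpret V: banach_space_over sc by (rule sc)
  interpret Sk: Vector_Spaces.linear sc sc S by (rule bounded_opsD[OF S])
  note bsc = banach_space_over_bounded_linear_scale[OF sc]
  have hc: "hypercyclic_vector T x" by (rule u_frequently_hypercyclic_imp_hypercyclic[OF x])
  note qn = qn[OF hc]
  obtain a :: 'a where a: "a \<noteq> 0"
  proof (rule ccontr)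
    assume "\<not> thesis"
    then have "(UNIV :: 'a set) = {0}" using that by blast
    then have "UNIV \<subseteq> V.span {}" by simp
    then show False using inf unfolding infinite_dim_def by (meson empty_subsetI finite.emptyI)
  qed
  obtain \<phi> :: "'a \<Rightarrow> real" where \<phi>: "bounded_linear \<phi>" "\<phi> a = norm a" using norming_functional by blast
  interpret \<phi>: bounded_linear \<phi> by (rule \<phi>)
  have \<phi>a: "\<phi> a \<noteq> 0" using a \<phi>(2) by simp
  show False
  proof (cases "z = 0")
    case True
    have "rapidly_decaying (\<lambda>n. \<phi> ((S ^^ n) x))"
      using qn[of 1] \<phi>(1) by (simp add: weakly_quasinilpotent_def)
    then obtain C where C: "\<And>n. \<bar>\<phi> ((S ^^ n) x)\<bar> \<le> C * 1 ^ n"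
      unfolding rapidly_decaying_def using zero_less_one by blast
    have "open {y. C < \<phi> y}" by (intro open_Collect_less continuous_intros linear_continuous_on \<phi>(1))
    moreover have "((C + 1) / \<phi> a) *\<^sub>R a \<in> {y. C < \<phi> y}" using \<phi>a by (simp add: \<phi>.scaleR)
    ultimately obtain n where "(T ^^ n) x \<in> {y. C < \<phi> y}"
      using hc unfolding hypercyclic_vector_def by blast
    moreover have "T = S" using T True by auto
    ultimately show False using C[of n] by simp
  next
    case False
    define N where "N x = sc (1 / z) (S x)" for x
    have Nb: "bounded_linear N" unfolding N_def
      by (intro bounded_linear_compose[OF bsc] bounded_opsD[OF S])
    have Nsc: "N (sc c y) = sc c (N y)" for c y by (simp add: N_def Sk.scale)
    have Nq: "weakly_quasinilpotent N" using qn[of "1 / z"] by (simp add: N_def[abs_def])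
    have TN: "T y = sc z (y + N y)" for y using False by (simp add: T N_def V.scale_right_distrib)
    \<comment> \<open>The range of \<open>N\<close> is that of \<open>S\<close>, which is the case \<open>a = 0\<close> of \<open>hypercyclic_dense_range\<close>.\<close>
    have dense: "closure (range N) = UNIV"
    proof -
      have "S y \<in> range N" for y
        using False by (intro image_eqI[of _ _ "sc z y"]) (auto simp: N_def Sk.scale)
      then have "range (\<lambda>x. sc 0 x + S x) \<subseteq> range N" by auto
      then show ?thesis
        using hypercyclic_dense_range[OF sc bounded_opsD(2)[OF S] hc[unfolded T], of 0] closure_mono by blast
    qed
    have "\<exists>y. \<phi> (N y) \<noteq> c * \<phi> y" for c
      using weakly_quasinilpotent_no_eigenfunctional[OF Nb Nq dense \<phi>(1)] \<phi>a by blast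
    then obtain u where u: "\<phi> u = 1" "\<phi> (N u) = -2"
      using independent_functionals_values[OF \<phi>.linear
          bounded_linear.linear[OF bounded_linear_compose[OF \<phi>(1) Nb]] \<phi>a] by metis
    obtain r where r: "0 < r" "\<And>x. null_density {n. (T ^^ n) x \<in> ball u r}"
      using return_set_null_density[OF sc False Nb Nsc Nq TN \<phi>(1) u] by blast
    have "null_density {n. 0 < n \<and> (T ^^ n) x \<in> ball u r}"
      by (rule null_density_subset[OF r(2)[of x]]) blast
    then have "upper_density {n. 0 < n \<and> (T ^^ n) x \<in> ball u r} = 0" by (rule upper_density_null)
    moreover have "open (ball u r) \<and> ball u r \<noteq> {}" using r(1) by simp
    then have "0 < upper_density {n. 0 < n \<and> (T ^^ n) x \<in> ball u r}" by (rule x[rule_format])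
    ultimately show False by simp
  qed
qed

lemma frequently_hypercyclic_imp_u_frequently_hypercyclic:
  "frequently_hypercyclic T \<Longrightarrow> u_frequently_hypercyclic T"
proof -
  have "lower_density A \<le> upper_density A" for A
    unfolding lower_density_def upper_density_def by (intro Liminf_le_Limsup) simp
  then show "frequently_hypercyclic T \<Longrightarrow> u_frequently_hypercyclic T"
    unfolding frequently_hypercyclic_def u_frequently_hypercyclic_def by (meson less_le_trans)
qed

lemma class_Phi_real_no_ufhc:
  assumes Phi: "class_Phi (scaleR :: real \<Rightarrow> 'a::banach \<Rightarrow> 'a)" and T: "T \<in> bounded_ops (scaleR :: real \<Rightarrow> 'a \<Rightarrow> 'a)"
  shows "\<not> u_frequently_hypercyclic T"
proof -
  obtain z S where S: "S \<in> strictly_singular_ops (scaleR :: real \<Rightarrow> 'a \<Rightarrow> 'a)" and zS: "T = (\<lambda>x. z *\<^sub>R x + S x)"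
    using class_Phi_decomp[OF Phi T] by blast
  have sc: "banach_space_over (scaleR :: real \<Rightarrow> 'a \<Rightarrow> 'a)" and inf: "infinite_dim (scaleR :: real \<Rightarrow> 'a \<Rightarrow> 'a) UNIV"
    using Phi by (simp_all add: class_Phi_def)
  have Sb: "S \<in> bounded_ops scaleR" using S by (simp add: strictly_singular_ops_def)
  show ?thesis
    by (rule not_u_frequently_hypercyclic[OF sc inf Sb zS]) (simp add: zS weakly_quasinilpotent_real[OF S])
qed

lemma class_Phi_complex_no_ufhc:
  fixes sc :: "complex \<Rightarrow> 'a::banach \<Rightarrow> 'a"
  assumes Phi: "class_Phi sc" and T: "T \<in> bounded_ops sc"
  shows "\<not> u_frequently_hypercyclic T"
proof -
  obtain z S where S: "S \<in> strictly_singular_ops sc" and zS: "T = (\<lambda>x. sc z x + S x)"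
    using class_Phi_decomp[OF Phi T] by blast
  have sc: "banach_space_over sc" and inf: "infinite_dim sc UNIV"
    using Phi by (simp_all add: class_Phi_def)
  have Sb: "S \<in> bounded_ops sc" using S by (simp add: strictly_singular_ops_def)
  show ?thesis
    by (rule not_u_frequently_hypercyclic[OF sc inf Sb zS]) (simp add: zS weakly_quasinilpotent_complex[OF sc S])
qed

theorem theorem1p3:
  fixes scaleC :: "complex \<Rightarrow> 'b::banach \<Rightarrow> 'b"
  shows "(class_Phi (scaleR :: real \<Rightarrow> 'a::banach \<Rightarrow> 'a) \<longrightarrow>
      \<not> (\<exists>T \<in> bounded_ops (scaleR :: real \<Rightarrow> 'a \<Rightarrow> 'a). u_frequently_hypercyclic T) \<and>
      \<not> (\<exists>T \<in> bounded_ops (scaleR :: real \<Rightarrow> 'a \<Rightarrow> 'a). frequently_hypercyclic T)) \<and>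
    (class_Phi scaleC \<longrightarrow>
      \<not> (\<exists>T \<in> bounded_ops scaleC. u_frequently_hypercyclic T) \<and>
      \<not> (\<exists>T \<in> bounded_ops scaleC. frequently_hypercyclic T))"
proof (intro conjI impI notI)
  assume Phi: "class_Phi (scaleR :: real \<Rightarrow> 'a \<Rightarrow> 'a)"
  note no = class_Phi_real_no_ufhc[OF Phi]
  show False if "\<exists>T \<in> bounded_ops (scaleR :: real \<Rightarrow> 'a \<Rightarrow> 'a). u_frequently_hypercyclic T"
    using no that by blast
  show False if "\<exists>T \<in> bounded_ops (scaleR :: real \<Rightarrow> 'a \<Rightarrow> 'a). frequently_hypercyclic T"
    using no frequently_hypercyclic_imp_u_frequently_hypercyclic that by blast
next
  assume Phi: "class_Phi scaleC"
  note no = class_Phi_complex_no_ufhc[OF Phi]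
  show False if "\<exists>T \<in> bounded_ops scaleC. u_frequently_hypercyclic T"
    using no that by blast
  show False if "\<exists>T \<in> bounded_ops scaleC. frequently_hypercyclic T"
    using no frequently_hypercyclic_imp_u_frequently_hypercyclic that by blast
qed

end
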